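(* Let $\alpha$ be an infinite cardinal and let $G$ be an $\alpha$-pseudocompact abelian group. If $G$ is $c_\alpha$-extremal, then $r_0(G)\leq 2^\alpha$.
   Context: All topological spaces and groups are assumed to be Tychonov (in particular Hausdorff). Let $\alpha$ be an infinite cardinal. A topological space $X$ is $\alpha$-pseudocompact if $f(X)$ is compact for every continuous function $f:X\to\mathbb{R}^\alpha$; a topological group is $\alpha$-pseudocompact if its underlying space is, and subgroups carry the subspace topology. $r_0(A)$ denotes the free rank of an abelian group $A$. An $\alpha$-pseudocompact abelian group $G$ is $c_\alpha$-extremal if $r_0(G/D)<2^\alpha$ for every dense $\alpha$-pseudocompact subgroup $D$ of $G$. *)

theory Defs
  imports "HOL-Analysis.Analysis" "HOL-Algebra.Coset" "HOL-Algebra.FiniteProduct"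
begin

unbundle cardinal_syntax

text \<open>
  Cardinals are represented, as in the library, by cardinal orders \<open>\<alpha>\<close>; the set
  \<open>Field \<alpha>\<close> has cardinality \<open>\<alpha>\<close>, the product \<open>\<real>\<^sup>\<alpha>\<close> is indexed by \<open>Field \<alpha>\<close>, and \<open>2\<^sup>\<alpha>\<close>
  is \<open>ctwo ^c \<alpha>\<close>.
\<close>

definition tychonov_space :: "'a topology \<Rightarrow> bool" where
  "tychonov_space T \<longleftrightarrow> completely_regular_space T \<and> Hausdorff_space T"

locale topological_group = group G
  for G :: "('a, 'm) monoid_scheme" (structure) and T :: "'a topology" +
  assumes topspace_eq_carrier: "topspace T = carrier G"
    and tychonov: "tychonov_space T"
    and continuous_mult: "continuous_map (prod_topology T T) T (\<lambda>(x, y). x \<otimes> y)"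
    and continuous_inv: "continuous_map T T (\<lambda>x. inv x)"

definition alpha_pseudocompact :: "'i rel \<Rightarrow> 'a topology \<Rightarrow> bool" where
  "alpha_pseudocompact \<alpha> T \<longleftrightarrow>
     (\<forall>f. continuous_map T (powertop_real (Field \<alpha>)) f \<longrightarrow>
          compactin (powertop_real (Field \<alpha>)) (f ` topspace T))"

definition group_independent :: "('a, 'm) monoid_scheme \<Rightarrow> 'a set \<Rightarrow> bool" where
  "group_independent A X \<longleftrightarrow> X \<subseteq> carrier A \<and>
     (\<forall>F (n :: 'a \<Rightarrow> int). finite F \<longrightarrow> F \<subseteq> X \<longrightarrow>
        finprod A (\<lambda>x. x [^]\<^bsub>A\<^esub> n x) F = \<one>\<^bsub>A\<^esub> \<longrightarrow> (\<forall>x\<in>F. n x = 0))"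

definition maximal_independent :: "('a, 'm) monoid_scheme \<Rightarrow> 'a set \<Rightarrow> bool" where
  "maximal_independent A X \<longleftrightarrow> group_independent A X \<and>
     (\<forall>Y. group_independent A Y \<longrightarrow> X \<subseteq> Y \<longrightarrow> Y = X)"

text \<open>
  The free rank of an abelian group is the cardinality of a maximal independent subset.
  Such a set exists by \<open>maximal_independent_exists\<close> below, and any two of them have the
  same cardinality.
\<close>

definition free_rank :: "('a, 'm) monoid_scheme \<Rightarrow> 'a rel" where
  "free_rank A = |SOME X. maximal_independent A X|"

definition c_extremal :: "'i rel \<Rightarrow> ('a, 'm) monoid_scheme \<Rightarrow> 'a topology \<Rightarrow> bool" where
  "c_extremal \<alpha> G T \<longleftrightarrow>
     (\<forall>D. subgroup D G \<and> T closure_of D = topspace T \<and> alpha_pseudocompact \<alpha> (subtopology T D)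
          \<longrightarrow> free_rank (G Mod D) <o ctwo ^c \<alpha>)"

lemma maximal_independent_exists:
  assumes "comm_group A"
  shows "\<exists>X. maximal_independent A X"
proof -
  interpret comm_group A by fact
  let ?I = "{X. group_independent A X}"
  have empty: "{} \<in> ?I"
    by (simp add: group_independent_def)
  have "\<exists>M\<in>?I. \<forall>X\<in>?I. M \<subseteq> X \<longrightarrow> X = M"
  proof (rule subset_Zorn_nonempty)
    show "?I \<noteq> {}" using empty by blast
  next
    fix \<C> assume ne: "\<C> \<noteq> {}" and ch: "subset.chain ?I \<C>"
    have sub: "\<C> \<subseteq> ?I" using ch by (simp add: subset_chain_def)
    have "n x = 0"
      if F: "finite F" "F \<subseteq> \<Union>\<C>" "finprod A (\<lambda>x. x [^]\<^bsub>A\<^esub> n x) F = \<one>\<^bsub>A\<^esub>" "x \<in> F"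
      for F x and n :: "'a \<Rightarrow> int"
    proof -
      obtain B where "B \<in> \<C>" "F \<subseteq> B"
        using finite_subset_Union_chain[OF F(1,2) ne ch] by blast
      then show ?thesis using F sub unfolding group_independent_def by blast
    qed
    moreover have "\<Union>\<C> \<subseteq> carrier A"
      using sub unfolding group_independent_def by blast
    ultimately show "\<Union>\<C> \<in> ?I"
      unfolding group_independent_def by blast
  qed
  then show ?thesis unfolding maximal_independent_def by blast
qed

end

theory Submission
  imports Defs
begin

text \<open>
  Let \<open>X\<close> be a maximal independent set, split into countably many disjoint pieces \<open>X\<^sub>n\<close> of the
  cardinality of \<open>X\<close>. The pure spans of the sets \<open>X - X\<^sub>n\<close> cover \<open>G\<close>, so by a Baire argument one of
  them is dense, with respect to intersections of \<open>\<alpha>\<close> open sets, in such an intersection \<open>Z\<close>. As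
  \<open>G\<close> is totally bounded, \<open>2\<^sup>\<alpha>\<close> translates of \<open>Z\<close> cover \<open>G\<close>, and enlarging the span by the pure
  span of a set \<open>Y \<subseteq> X\<close> with \<open>|Y| \<le> 2\<^sup>\<alpha>\<close> gives a subgroup \<open>D\<close> that meets every nonempty
  intersection of \<open>\<alpha>\<close> open sets. Since \<open>G\<close> satisfies the countable chain condition, every continuous
  map from \<open>D\<close> to \<open>\<real>\<^sup>\<alpha>\<close> extends to \<open>G\<close> with the same image, so \<open>D\<close> is \<open>\<alpha>\<close>-pseudocompact.
  But \<open>X\<^sub>n - Y\<close> is independent modulo \<open>D\<close>, so extremality bounds its cardinality by \<open>2\<^sup>\<alpha>\<close>.
\<close>

section \<open>Cardinal estimates\<close>

lemma card_of_Pow_ordLeq: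
  assumes "|A| \<le>o |B|"
  shows "|Pow A| \<le>o |Pow B|"
proof -
  obtain h where h: "inj_on h A" "h ` A \<subseteq> B" using assms card_of_ordLeq by metis
  have "inj_on ((`) h) (Pow A)" using h(1) by (rule inj_on_image_Pow)
  moreover have "((`) h) ` Pow A \<subseteq> Pow B" using h(2) by blast
  ultimately show ?thesis using card_of_ordLeq by metis
qed

lemma card_of_countable_ordLeq:
  assumes "countable A" "infinite B"
  shows "|A| \<le>o |B|"
proof -
  have "|A| \<le>o |UNIV :: nat set|"
    using assms(1) by (intro card_of_ordLeqI[OF inj_on_to_nat_on]) auto
  then show ?thesis using assms(2) infinite_iff_card_of_nat ordLeq_transitive by blast
qed

section \<open>Spans in abelian groups\<close>

definition int_span :: "('a, 'm) monoid_scheme \<Rightarrow> 'a set \<Rightarrow> 'a set" where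
  "int_span G B = {g. \<exists>F (n :: 'a \<Rightarrow> int). finite F \<and> F \<subseteq> B \<and> g = finprod G (\<lambda>x. x [^]\<^bsub>G\<^esub> n x) F}"

text \<open>For \<open>B\<close> inside the carrier this is the pure closure (isolator) of the
  subgroup generated by \<open>B\<close>: the preimage of the torsion subgroup of the quotient by
  it. It contains all torsion elements.\<close>

definition pure_span :: "('a, 'm) monoid_scheme \<Rightarrow> 'a set \<Rightarrow> 'a set" where
  "pure_span G B = {g \<in> carrier G. \<exists>m :: int. m \<noteq> 0 \<and> g [^]\<^bsub>G\<^esub> m \<in> int_span G B}"

lemma group_independentD:
  assumes "group_independent A X" "finite F" "F \<subseteq> X"
    and "finprod A (\<lambda>x. x [^]\<^bsub>A\<^esub> n x) F = \<one>\<^bsub>A\<^esub>" "x \<in> F"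
  shows "n x = (0 :: int)"
  using assms unfolding group_independent_def by blast

lemma int_spanI:
  "finite F \<Longrightarrow> F \<subseteq> B \<Longrightarrow> finprod G (\<lambda>x. x [^]\<^bsub>G\<^esub> (n x :: int)) F \<in> int_span G B"
  unfolding int_span_def by blast

lemma int_span_mono: "B \<subseteq> C \<Longrightarrow> int_span G B \<subseteq> int_span G C"
  unfolding int_span_def by blast

lemma pure_span_mono: "B \<subseteq> C \<Longrightarrow> pure_span G B \<subseteq> pure_span G C"
  unfolding pure_span_def using int_span_mono by blast

lemma pure_spanE:
  assumes "g \<in> pure_span G B"
  obtains m :: int where "m \<noteq> 0" "g [^]\<^bsub>G\<^esub> m \<in> int_span G B"
  using assms unfolding pure_span_def by blast

text \<open>Membership is witnessed by a single relation, which involves finitely many elements of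
  \<open>B\<close>. A finite support cannot meet infinitely many disjoint pieces of a maximal
  independent set, and the cover of the group rests on this.\<close>

lemma pure_span_finite_support:
  assumes "g \<in> pure_span G B"
  obtains F where "finite F" "F \<subseteq> B" "g \<in> pure_span G F"
  using assms unfolding pure_span_def int_span_def by blast

context comm_group
begin

lemma finprod_int_pow:
  assumes "F \<subseteq> carrier G"
  shows "finprod G (\<lambda>x. x [^] (n x :: int)) F [^] (k :: int) = finprod G (\<lambda>x. x [^] (n x * k)) F"
  using assms
proof (induction F rule: infinite_finite_induct)
  case (insert x F)
  then have "(\<lambda>x. x [^] n x) \<in> F \<rightarrow> carrier G" "(\<lambda>x. x [^] (n x * k)) \<in> F \<rightarrow> carrier G" "x \<in> carrier G"
    by auto
  with insert show ?case by (simp add: int_pow_distrib int_pow_pow)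
qed auto

lemma int_span_closed: "B \<subseteq> carrier G \<Longrightarrow> g \<in> int_span G B \<Longrightarrow> g \<in> carrier G"
  unfolding int_span_def by (auto intro!: finprod_closed)

lemma int_span_int_pow:
  assumes "B \<subseteq> carrier G" "g \<in> int_span G B"
  shows "g [^] (k :: int) \<in> int_span G B"
proof -
  from assms(2) obtain F and n :: "'a \<Rightarrow> int" where F: "finite F" "F \<subseteq> B" "g = finprod G (\<lambda>x. x [^] n x) F"
    unfolding int_span_def by blast
  then have "F \<subseteq> carrier G" using assms(1) by simp
  then have "g [^] k = finprod G (\<lambda>x. x [^] (n x * k)) F"
    unfolding F(3) by (rule finprod_int_pow)
  with int_spanI[OF F(1,2), of G "\<lambda>x. n x * k"] show ?thesis by simp
qed

lemma int_span_mult: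
  assumes B: "B \<subseteq> carrier G" and "g \<in> int_span G B" "h \<in> int_span G B"
  shows "g \<otimes> h \<in> int_span G B"
proof -
  from assms obtain F F' and n n' :: "'a \<Rightarrow> int" where
    F: "finite F" "F \<subseteq> B" "g = finprod G (\<lambda>x. x [^] n x) F" and
    F': "finite F'" "F' \<subseteq> B" "h = finprod G (\<lambda>x. x [^] n' x) F'"
    unfolding int_span_def by blast
  \<comment> \<open>Exponent 0 outside \<open>E\<close> puts both products on the common index set,
    where they can be multiplied termwise.\<close>
  have ext: "finprod G (\<lambda>x. x [^] k x) E = finprod G (\<lambda>x. x [^] (if x \<in> E then k x else 0)) (F \<union> F')"
    if "E \<subseteq> F \<union> F'" for E and k :: "'a \<Rightarrow> int"
    by (rule finprod_mono_neutral_cong_left) (use that F F' B in auto)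
  have "g \<otimes> h = finprod G (\<lambda>x. x [^] (if x \<in> F then n x else 0) \<otimes> x [^] (if x \<in> F' then n' x else 0)) (F \<union> F')"
    unfolding F(3) F'(3) using F(2) F'(2) B
    by (subst ext[of F], simp, subst ext[of F'], simp) (auto intro!: finprod_multf[symmetric] int_pow_closed)
  also have "\<dots> = finprod G (\<lambda>x. x [^] ((if x \<in> F then n x else 0) + (if x \<in> F' then n' x else 0))) (F \<union> F')"
  proof (rule finprod_cong')
    show "x [^] (if x \<in> F then n x else 0) \<otimes> x [^] (if x \<in> F' then n' x else 0)
       = x [^] ((if x \<in> F then n x else 0) + (if x \<in> F' then n' x else 0))" if "x \<in> F \<union> F'" for x
      using int_pow_mult[of x "if x \<in> F then n x else 0" "if x \<in> F' then n' x else 0"] that F F' B by auto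
  qed (use F F' B in auto)
  finally have eq: "g \<otimes> h = finprod G (\<lambda>x. x [^] ((if x \<in> F then n x else 0) + (if x \<in> F' then n' x else 0))) (F \<union> F')" .
  show ?thesis unfolding eq by (rule int_spanI) (use F F' in auto)
qed

lemma int_span_superset: "B \<subseteq> carrier G \<Longrightarrow> B \<subseteq> int_span G B"
proof
  fix b assume "B \<subseteq> carrier G" "b \<in> B"
  then show "b \<in> int_span G B" unfolding int_span_def
    by (intro CollectI exI[of _ "{b}"] exI[of _ "\<lambda>_. 1"]) (auto simp: Pi_def)
qed

lemma one_in_int_span: "\<one> \<in> int_span G B"
  unfolding int_span_def by (intro CollectI exI[of _ "{}"]) auto

lemma int_span_subset_pure_span: "B \<subseteq> carrier G \<Longrightarrow> int_span G B \<subseteq> pure_span G B"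
  using int_span_closed unfolding pure_span_def by (fastforce intro: exI[of _ 1])

lemma subgroup_pure_span:
  assumes B: "B \<subseteq> carrier G"
  shows "subgroup (pure_span G B) G"
proof (rule subgroupI)
  show "pure_span G B \<subseteq> carrier G" by (auto simp: pure_span_def)
  show "pure_span G B \<noteq> {}" using int_span_subset_pure_span[OF B] one_in_int_span by blast
  fix g assume g: "g \<in> pure_span G B"
  then obtain m :: int where m: "g \<in> carrier G" "m \<noteq> 0" "g [^] m \<in> int_span G B"
    by (auto simp: pure_span_def)
  have "inv g [^] (- m) = g [^] m" using m by (simp add: int_pow_inv int_pow_neg)
  then show "inv g \<in> pure_span G B" unfolding pure_span_def
    using m by (auto intro!: exI[of _ "- m"])
  fix h assume "h \<in> pure_span G B"
  then obtain k :: int where k: "h \<in> carrier G" "k \<noteq> 0" "h [^] k \<in> int_span G B"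
    by (auto simp: pure_span_def)
  have "(g \<otimes> h) [^] (m * k) = (g [^] m) [^] k \<otimes> (h [^] k) [^] m"
    using m k by (simp add: int_pow_distrib int_pow_pow mult.commute)
  also have "\<dots> \<in> int_span G B"
    by (intro int_span_mult int_span_int_pow B m k)
  finally show "g \<otimes> h \<in> pure_span G B"
    unfolding pure_span_def using m k by (auto intro!: exI[of _ "m * k"])
qed

text \<open>Adding an outside element \<open>g\<close> to \<open>X\<close> creates a nontrivial
  relation. It must involve \<open>g\<close> with nonzero exponent, since otherwise it would be a
  relation within \<open>X\<close>; solving it for the power of \<open>g\<close> gives the
  claim.\<close>

lemma maximal_independent_pure_span:
  assumes "maximal_independent G X"
  shows "carrier G \<subseteq> pure_span G X"
proof
  fix g assume g: "g \<in> carrier G"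
  have ind: "group_independent G X" and X: "X \<subseteq> carrier G"
    using assms by (auto simp: maximal_independent_def group_independent_def)
  show "g \<in> pure_span G X"
  proof (cases "g \<in> X")
    case True
    then show ?thesis using int_span_superset[OF X] int_span_subset_pure_span[OF X] by blast
  next
    case False
    then have "\<not> group_independent G (insert g X)"
      using assms by (auto simp: maximal_independent_def)
    then obtain F and n :: "'a \<Rightarrow> int" where F: "finite F" "F \<subseteq> insert g X"
        "finprod G (\<lambda>x. x [^] n x) F = \<one>" and nz: "\<exists>x\<in>F. n x \<noteq> 0"
      using X g unfolding group_independent_def by auto
    have Fc: "F - {g} \<subseteq> X" "F - {g} \<subseteq> carrier G" using F X by auto
    have gF: "g \<in> F"
      using F nz ind unfolding group_independent_def by blast
    have cl: "(\<lambda>x. x [^] n x) \<in> (F - {g}) \<rightarrow> carrier G" using Fc by auto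
    have eq: "g [^] n g \<otimes> finprod G (\<lambda>x. x [^] n x) (F - {g}) = \<one>"
      using finprod_insert[of "F - {g}" g "\<lambda>x. x [^] n x"] cl F g gF by (simp add: insert_absorb)
    have ng: "n g \<noteq> 0"
    proof
      assume "n g = 0"
      then have "finprod G (\<lambda>x. x [^] n x) (F - {g}) = \<one>" using eq cl by simp
      then have "\<forall>x\<in>F - {g}. n x = 0"
        using ind F Fc unfolding group_independent_def by blast
      with nz \<open>n g = 0\<close> show False by blast
    qed
    let ?p = "finprod G (\<lambda>x. x [^] n x) (F - {g})"
    have p: "?p \<in> int_span G X" unfolding int_span_def using F Fc by blast
    have "g [^] n g = inv ?p"
      using eq g cl by (metis finprod_closed int_pow_closed inv_equality inv_inv)
    also have "\<dots> = ?p [^] (-1 :: int)" using cl by (simp add: int_pow_neg)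
    finally have "g [^] n g \<in> int_span G X" using int_span_int_pow[OF X p] by simp
    with ng g show ?thesis unfolding pure_span_def by blast
  qed
qed

text \<open>Membership would give a relation between \<open>x\<close>, \<open>y\<close> and finitely
  many elements of \<open>B\<close>, nontrivial because neither \<open>x\<close> nor
  \<open>y\<close> lies in \<open>B\<close>. Hence equal nonzero powers of distinct elements of
  \<open>X - B\<close> lie in distinct cosets.\<close>

lemma independent_mod_pure_span:
  assumes ind: "group_independent G X" and "B \<subseteq> X" "x \<in> X - B" "y \<in> X - B" "x \<noteq> y" "m \<noteq> (0 :: int)"
  shows "x [^] m \<otimes> inv (y [^] m) \<notin> pure_span G B"
proof
  assume "x [^] m \<otimes> inv (y [^] m) \<in> pure_span G B"
  then obtain k :: int and F and n :: "'a \<Rightarrow> int" where k: "k \<noteq> 0"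
    and F: "finite F" "F \<subseteq> B" "(x [^] m \<otimes> inv (y [^] m)) [^] k = finprod G (\<lambda>x. x [^] n x) F"
    unfolding pure_span_def int_span_def by blast
  have X: "X \<subseteq> carrier G" using ind by (simp add: group_independent_def)
  then have c: "x \<in> carrier G" "y \<in> carrier G" "F \<subseteq> carrier G" using assms F by auto
  have xy: "(x [^] m \<otimes> inv (y [^] m)) [^] k = x [^] (m * k) \<otimes> inv (y [^] (m * k))"
    using c by (simp add: int_pow_distrib int_pow_pow int_pow_inv)
  \<comment> \<open>The relation brought to one side: the inverse of the left-hand power contributes
    the exponents at \<open>x\<close> and \<open>y\<close>.\<close>
  let ?n = "\<lambda>z. if z = x then - (m * k) else if z = y then m * k else n z"
  have nF: "x \<notin> F" "y \<notin> F" using F assms by auto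
  have pF: "finprod G (\<lambda>z. z [^] ?n z) F = finprod G (\<lambda>x. x [^] n x) F"
    by (rule finprod_cong') (use nF c in auto)
  have cl: "(\<lambda>z. z [^] ?n z) \<in> A \<rightarrow> carrier G" if "A \<subseteq> carrier G" for A using that by auto
  have "finprod G (\<lambda>z. z [^] ?n z) (insert x (insert y F))
      = x [^] ?n x \<otimes> (y [^] ?n y \<otimes> finprod G (\<lambda>z. z [^] ?n z) F)"
    using F(1) nF assms(5) c cl by simp
  also have "\<dots> = inv (x [^] (m * k)) \<otimes> (y [^] (m * k) \<otimes> (x [^] (m * k) \<otimes> inv (y [^] (m * k))))"
    using assms(5) pF F(3) xy c by (simp add: int_pow_neg)
  also have "\<dots> = \<one>" using c by (simp add: m_lcomm)
  finally have "finprod G (\<lambda>z. z [^] ?n z) (insert x (insert y F)) = \<one>" .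
  moreover have "insert x (insert y F) \<subseteq> X" using assms F by auto
  ultimately have "?n x = 0"
    using group_independentD[OF ind, of "insert x (insert y F)" ?n x] F(1) by blast
  then have "m * k = 0" by simp
  with k assms(6) show False by simp
qed

lemma card_int_span:
  assumes inf: "infinite C" and B: "B \<subseteq> carrier G" and le: "|B| \<le>o |C|"
  shows "|int_span G B| \<le>o |C|"
proof -
  \<comment> \<open>\<open>S k\<close> consists of products of \<open>k\<close> integer powers of
    elements of \<open>B\<close>. Each stage is an image of the previous one times \<open>B\<close>
    times the integers, and the span lies in the countable union of the stages.\<close>
  define S where "S = rec_nat {\<one>} (\<lambda>_ A. (\<lambda>(a, b, n :: int). a \<otimes> b [^] n) ` (A \<times> B \<times> UNIV))"
  have S0: "S 0 = {\<one>}" and SS: "\<And>k. S (Suc k) = (\<lambda>(a, b, n :: int). a \<otimes> b [^] n) ` (S k \<times> B \<times> UNIV)"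
    by (simp_all add: S_def)
  have nat: "|UNIV :: nat set| \<le>o |C|" using inf infinite_iff_card_of_nat by blast
  have int: "|UNIV :: int set| \<le>o |C|" using card_of_countable_ordLeq[OF _ inf, of "UNIV :: int set"] by simp
  have card: "|S k| \<le>o |C|" for k
  proof (induction k)
    case 0
    have "|{\<one>}| \<le>o |C|" using inf by (metis card_of_singl_ordLeq finite.emptyI)
    then show ?case by (simp add: S0)
  next
    case (Suc k)
    have "|S k \<times> B \<times> (UNIV :: int set)| \<le>o |C|"
      using inf Suc le int by (intro card_of_Sigma_ordLeq_infinite ballI) auto
    then show ?case unfolding SS using card_of_image ordLeq_transitive by blast
  qed
  have "finprod G (\<lambda>x. x [^] n x) F \<in> (\<Union>k. S k)" if "finite F" "F \<subseteq> B" for F and n :: "'a \<Rightarrow> int"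
    using that
  proof (induction F rule: finite_induct)
    case empty
    have "\<one> \<in> S 0" by (simp add: S0)
    then show ?case unfolding finprod_empty by blast
  next
    case (insert x F)
    then obtain k where k: "finprod G (\<lambda>x. x [^] n x) F \<in> S k" by blast
    have c: "x \<in> carrier G" "(\<lambda>x. x [^] n x) \<in> F \<rightarrow> carrier G" using insert B by auto
    then have "finprod G (\<lambda>x. x [^] n x) (insert x F) = finprod G (\<lambda>x. x [^] n x) F \<otimes> x [^] n x"
      using insert by (simp add: m_comm finprod_closed)
    also have "\<dots> \<in> S (Suc k)" unfolding SS using k insert by force
    finally show ?case by blast
  qed
  then have "int_span G B \<subseteq> (\<Union>k. S k)" unfolding int_span_def by blast
  moreover have "|\<Union>k. S k| \<le>o |C|"
    using card_of_UNION_ordLeq_infinite[OF inf nat] card by blast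
  ultimately show ?thesis using card_of_mono1 ordLeq_transitive by blast
qed

text \<open>Powers that coincide modulo the pure span of \<open>B\<close> are counted in \<open>\<int> \<times> int_span Y\<close>;
  this replaces the invariance of the rank of a free module.\<close>

lemma card_independent_le_quotient:
  assumes ind: "group_independent G X" and BX: "B \<subseteq> X" and inf: "infinite C"
    and Y: "maximal_independent (G Mod pure_span G B) Y" and le: "|Y| \<le>o |C|"
  shows "|X - B| \<le>o |C|"
proof -
  let ?D = "pure_span G B" and ?Q = "G Mod pure_span G B"
  have X: "X \<subseteq> carrier G" using ind by (simp add: group_independent_def)
  have sub: "subgroup ?D G" using subgroup_pure_span BX X by blast
  then have normal: "?D \<lhd> G" using subgroup_imp_normal by blast
  interpret Q: comm_group ?Q using abelian_FactGroup[OF sub] .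
  have Yc: "Y \<subseteq> carrier ?Q" using Y by (simp add: maximal_independent_def group_independent_def)
  \<comment> \<open>Maximality of \<open>Y\<close> gives every coset a nonzero power in the span of
    \<open>Y\<close>.\<close>
  have "\<exists>m :: int. m \<noteq> 0 \<and> ?D #> (x [^] m) \<in> int_span ?Q Y" if "x \<in> X" for x
  proof -
    have xc: "x \<in> carrier G" using that X by blast
    then have "?D #> x \<in> pure_span ?Q Y"
      using Q.maximal_independent_pure_span[OF Y] by (auto simp: carrier_FactGroup)
    then obtain k :: int where "k \<noteq> 0" "(?D #> x) [^]\<^bsub>?Q\<^esub> k \<in> int_span ?Q Y"
      by (rule pure_spanE)
    then show ?thesis
      using normal.FactGroup_int_pow[OF normal xc] by metis
  qed
  then obtain m where m: "\<And>x. x \<in> X \<Longrightarrow> m x \<noteq> (0 :: int) \<and> ?D #> (x [^] m x) \<in> int_span ?Q Y"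
    by metis
  \<comment> \<open>Recording the exponent in the pair ensures that equal pairs compare powers with
    the same exponent, as \<open>independent_mod_pure_span\<close> requires.\<close>
  have "inj_on (\<lambda>x. (m x, ?D #> (x [^] m x))) (X - B)"
  proof (rule inj_onI)
    fix x y assume x: "x \<in> X - B" and y: "y \<in> X - B"
      and eq: "(m x, ?D #> (x [^] m x)) = (m y, ?D #> (y [^] m y))"
    then have c: "x \<in> carrier G" "y \<in> carrier G" using X by auto
    have "x [^] m x \<in> ?D #> (x [^] m x)"
      using rcos_self[OF int_pow_closed[OF c(1)] sub] .
    then have "x [^] m x \<in> ?D #> (y [^] m x)" using eq by (metis Pair_inject)
    then have "x [^] m x \<otimes> inv (y [^] m x) \<in> ?D"
      using c by (meson int_pow_closed is_group sub subgroup.rcos_module_imp)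
    then show "x = y"
      using independent_mod_pure_span[OF ind BX x y] m x by blast
  qed
  moreover have "(\<lambda>x. (m x, ?D #> (x [^] m x))) ` (X - B) \<subseteq> UNIV \<times> int_span ?Q Y"
    using m by auto
  ultimately have 1: "|X - B| \<le>o |(UNIV :: int set) \<times> int_span ?Q Y|"
    using card_of_ordLeq by blast
  have "|(UNIV :: int set) \<times> int_span ?Q Y| \<le>o |C|"
    using Q.card_int_span[OF inf Yc le] card_of_countable_ordLeq[OF _ inf, of "UNIV :: int set"] inf by (intro card_of_Sigma_ordLeq_infinite ballI) auto
  with 1 show ?thesis by (rule ordLeq_transitive)
qed

end

section \<open>Pseudocompact spaces\<close>

text \<open>Repeating \<open>f\<close> in every coordinate gives a map into the power of the reals;
  its compact image projects onto the image of \<open>f\<close>.\<close>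

lemma alpha_pseudocompact_bounded:
  fixes f :: "'a \<Rightarrow> real"
  assumes pc: "alpha_pseudocompact \<alpha> X" and ne: "Field \<alpha> \<noteq> {}" and f: "continuous_map X euclideanreal f"
  obtains B where "\<And>x. x \<in> topspace X \<Longrightarrow> \<bar>f x\<bar> \<le> B"
proof -
  obtain i where i: "i \<in> Field \<alpha>" using ne by blast
  let ?F = "\<lambda>x. \<lambda>i\<in>Field \<alpha>. f x"
  have "continuous_map X (powertop_real (Field \<alpha>)) ?F"
    by (rule continuous_map_componentwise[THEN iffD2]) (use f in auto)
  then have "compactin (powertop_real (Field \<alpha>)) (?F ` topspace X)"
    using pc by (simp add: alpha_pseudocompact_def)
  then have "compactin euclideanreal ((\<lambda>t. t i) ` ?F ` topspace X)"
    by (rule image_compactin) (rule continuous_map_product_projection[OF i])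
  then have "bounded ((\<lambda>t. t i) ` ?F ` topspace X)" by (simp add: compact_imp_bounded)
  moreover have "(\<lambda>t. t i) ` ?F ` topspace X = f ` topspace X" using i by (simp add: image_image)
  ultimately have "\<exists>B. \<forall>x\<in>topspace X. \<bar>f x\<bar> \<le> B" unfolding bounded_iff by simp
  then show ?thesis using that by blast
qed

text \<open>Indexed by \<open>Field \<alpha>\<close>, possibly with repetitions, the functions form
  one map into the power of the reals. Its image is compact, so the closed conditions that a
  coordinate vanish can be met together once finitely many always can.\<close>

lemma alpha_pseudocompact_common_zero:
  fixes \<G> :: "('a \<Rightarrow> real) set"
  assumes pc: "alpha_pseudocompact \<alpha> X" and card: "|\<G>| \<le>o |Field \<alpha>|"
    and cont: "\<And>g. g \<in> \<G> \<Longrightarrow> continuous_map X euclideanreal g"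
    and fip: "\<And>\<F>. finite \<F> \<Longrightarrow> \<F> \<subseteq> \<G> \<Longrightarrow> \<exists>x\<in>topspace X. \<forall>g\<in>\<F>. g x = 0"
  obtains x where "x \<in> topspace X" "\<And>g. g \<in> \<G> \<Longrightarrow> g x = 0"
proof (cases "\<G> = {}")
  case True
  then show ?thesis using fip[of "{}"] that by auto
next
  case False
  then obtain e where e: "e ` Field \<alpha> = \<G>" using card card_of_ordLeq2 by metis
  let ?F = "\<lambda>x. \<lambda>i\<in>Field \<alpha>. e i x" and ?P = "powertop_real (Field \<alpha>)"
  have "continuous_map X ?P ?F"
    by (rule continuous_map_componentwise[THEN iffD2]) (use cont e in auto)
  then have comp: "compactin ?P (?F ` topspace X)"
    using pc by (simp add: alpha_pseudocompact_def)
  let ?Z = "\<lambda>i. {t \<in> topspace ?P. t i \<in> {0}}"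
  have cl: "closedin ?P (?Z i)" if "i \<in> Field \<alpha>" for i
    by (rule closedin_continuous_map_preimage[OF continuous_map_product_projection[OF that]]) simp
  have "?F ` topspace X \<inter> \<Inter> (?Z ` Field \<alpha>) \<noteq> {}"
  proof (rule comp[unfolded compactin_fip, THEN conjunct2, rule_format], intro conjI ballI allI impI)
    show "closedin ?P C" if "C \<in> ?Z ` Field \<alpha>" for C using that cl by blast
    fix \<F> assume F: "finite \<F> \<and> \<F> \<subseteq> ?Z ` Field \<alpha>"
    then obtain J where J: "finite J" "J \<subseteq> Field \<alpha>" "\<F> = ?Z ` J" by (meson finite_subset_image)
    then obtain x where x: "x \<in> topspace X" "\<forall>g\<in>e ` J. g x = 0"
      using fip[of "e ` J"] e by blast
    have "?F x \<in> ?F ` topspace X \<inter> \<Inter> \<F>" using x J by (auto simp: PiE_iff)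
    then show "?F ` topspace X \<inter> \<Inter> \<F> \<noteq> {}" by blast
  qed
  then obtain x where x: "x \<in> topspace X" "?F x \<in> \<Inter> (?Z ` Field \<alpha>)" by blast
  then have "e i x = 0" if "i \<in> Field \<alpha>" for i using that by auto
  then show ?thesis using that x(1) e by blast
qed

text \<open>For countably infinite \<open>I\<close> this is density with respect to G-delta sets; in
  general, for infinite \<open>I\<close>, it is density in the finer topology based on intersections
  of at most \<open>|I|\<close> open sets.\<close>

definition card_dense_in :: "'i set \<Rightarrow> 'a topology \<Rightarrow> 'a set \<Rightarrow> bool" where
  "card_dense_in I X D \<longleftrightarrow> D \<subseteq> topspace X \<and>
     (\<forall>\<U>. |\<U>| \<le>o |I| \<longrightarrow> (\<forall>U\<in>\<U>. openin X U) \<longrightarrow> topspace X \<inter> \<Inter>\<U> \<noteq> {} \<longrightarrow> D \<inter> \<Inter>\<U> \<noteq> {})"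

lemma card_dense_inD:
  assumes "card_dense_in I X D" "|\<U>| \<le>o |I|" "\<And>U. U \<in> \<U> \<Longrightarrow> openin X U"
    and "x \<in> topspace X" "\<And>U. U \<in> \<U> \<Longrightarrow> x \<in> U"
  obtains d where "d \<in> D" "\<And>U. U \<in> \<U> \<Longrightarrow> d \<in> U"
proof -
  have "topspace X \<inter> \<Inter>\<U> \<noteq> {}" using assms(4,5) by blast
  with assms(1-3) have "D \<inter> \<Inter>\<U> \<noteq> {}" unfolding card_dense_in_def by blast
  then show ?thesis using that by blast
qed

lemma card_dense_in_closure_of:
  assumes "card_dense_in I X D" "infinite I"
  shows "X closure_of D = topspace X"
proof -
  have "y \<in> X closure_of D" if y: "y \<in> topspace X" for y
    unfolding in_closure_of
  proof (intro conjI allI impI y)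
    fix U assume U: "y \<in> U \<and> openin X U"
    have "|{U}| \<le>o |I|" using assms(2) by (metis card_of_singl_ordLeq finite.emptyI)
    then obtain d where "d \<in> D" "\<And>V. V \<in> {U} \<Longrightarrow> d \<in> V"
      using card_dense_inD[OF assms(1), of "{U}" y] U y by blast
    then show "\<exists>d. d \<in> D \<and> d \<in> U" by blast
  qed
  then show ?thesis using closure_of_subset_topspace[of X D] by blast
qed

text \<open>The Baire argument: otherwise one builds a decreasing sequence of nonempty intersections
  of zero sets, the \<open>n\<close>-th of which misses \<open>A n\<close>.\<close>

lemma alpha_pseudocompact_Baire:
  fixes A :: "nat \<Rightarrow> 'a set"
  assumes pc: "alpha_pseudocompact \<alpha> X" and inf: "infinite (Field \<alpha>)"
    and cr: "completely_regular_space X" and ne: "topspace X \<noteq> {}"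
    and cov: "topspace X \<subseteq> (\<Union>n. A n)"
  obtains n \<U> where "|\<U>| \<le>o |Field \<alpha>|" "\<And>U. U \<in> \<U> \<Longrightarrow> openin X U" "topspace X \<inter> \<Inter>\<U> \<noteq> {}"
    "\<And>\<P>. |\<P>| \<le>o |Field \<alpha>| \<Longrightarrow> (\<And>P. P \<in> \<P> \<Longrightarrow> openin X P) \<Longrightarrow> topspace X \<inter> \<Inter>\<U> \<inter> \<Inter>\<P> \<noteq> {} \<Longrightarrow>
       A n \<inter> topspace X \<inter> \<Inter>\<U> \<inter> \<Inter>\<P> \<noteq> {}"
proof (rule ccontr)
  note witness = that
  assume contra: "\<not> thesis"
  let ?I = "Field \<alpha>"
  have nat: "|UNIV :: nat set| \<le>o |?I|" using inf infinite_iff_card_of_nat by blast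
  define Zs where "Zs = (\<lambda>\<G> :: ('a \<Rightarrow> real) set. {x \<in> topspace X. \<forall>g\<in>\<G>. g x = 0})"
  \<comment> \<open>The stages of the Baire construction are families of functions rather than of
    open sets: their union is again small, and \<open>alpha_pseudocompact_common_zero\<close> yields
    a point in the limit.\<close>
  define good where "good = (\<lambda>\<G> :: ('a \<Rightarrow> real) set. |\<G>| \<le>o |?I| \<and>
      (\<forall>g\<in>\<G>. continuous_map X euclideanreal g) \<and> Zs \<G> \<noteq> {})"
  have step: "\<exists>\<G>'. good \<G>' \<and> \<G> \<subseteq> \<G>' \<and> Zs \<G>' \<inter> A n = {}" if good: "good \<G>" for \<G> n
  proof -
    \<comment> \<open>A zero set is written as an intersection of the open sets where
      \<open>|g| < 1 / (k + 1)\<close>, so that the negated conclusion applies to it.\<close>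
    define V where "V = (\<lambda>(g :: 'a \<Rightarrow> real, k :: nat). {x \<in> topspace X. g x \<in> ball 0 (1 / Suc k)})"
    let ?\<U> = "V ` (\<G> \<times> UNIV)"
    have "|\<G> \<times> (UNIV :: nat set)| \<le>o |?I|"
      using good nat inf by (intro card_of_Sigma_ordLeq_infinite) (auto simp: good_def)
    then have U1: "|?\<U>| \<le>o |?I|" using card_of_image ordLeq_transitive by blast
    have U2: "openin X U" if UV: "U \<in> ?\<U>" for U
    proof -
      obtain g k where "g \<in> \<G>" "U = V (g, k)" using UV by blast
      moreover have "openin X {x \<in> topspace X. g x \<in> ball 0 (1 / Suc k)}"
        using good \<open>g \<in> \<G>\<close> by (intro openin_continuous_map_preimage[of X euclideanreal]) (auto simp: good_def)
      ultimately show ?thesis by (simp add: V_def)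
    qed
    have U3: "topspace X \<inter> \<Inter>?\<U> = Zs \<G>"
    proof
      show "topspace X \<inter> \<Inter>?\<U> \<subseteq> Zs \<G>"
      proof
        fix x assume x: "x \<in> topspace X \<inter> \<Inter>?\<U>"
        have "g x = 0" if "g \<in> \<G>" for g
        proof (rule ccontr)
          assume "g x \<noteq> 0"
          then obtain k where "1 / real (Suc k) < \<bar>g x\<bar>"
            using nat_approx_posE[of "\<bar>g x\<bar>"] by auto
          moreover have "x \<in> V (g, k)" using x that by blast
          ultimately show False by (simp add: V_def)
        qed
        then show "x \<in> Zs \<G>" using x by (auto simp: Zs_def)
      qed
    qed (auto simp: Zs_def V_def)
    have "\<exists>\<P>. |\<P>| \<le>o |?I| \<and> (\<forall>P\<in>\<P>. openin X P) \<and> Zs \<G> \<inter> \<Inter>\<P> \<noteq> {} \<and> A n \<inter> Zs \<G> \<inter> \<Inter>\<P> = {}"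
    proof (rule ccontr)
      assume neg: "\<not> ?thesis"
      show False
      proof (rule contra[THEN notE], rule witness[where \<U> = ?\<U> and n = n, OF U1 U2])
        show "topspace X \<inter> \<Inter>?\<U> \<noteq> {}" using good U3 by (simp add: good_def)
        show "A n \<inter> topspace X \<inter> \<Inter>?\<U> \<inter> \<Inter>\<P> \<noteq> {}"
          if "|\<P>| \<le>o |?I|" "\<And>P. P \<in> \<P> \<Longrightarrow> openin X P" "topspace X \<inter> \<Inter>?\<U> \<inter> \<Inter>\<P> \<noteq> {}" for \<P>
          using neg that unfolding Int_assoc[of "A n"] U3 by blast
      qed
    qed
    then obtain \<P> p where P: "|\<P>| \<le>o |?I|" "\<And>P. P \<in> \<P> \<Longrightarrow> openin X P" "A n \<inter> Zs \<G> \<inter> \<Inter>\<P> = {}"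
      and p: "p \<in> Zs \<G>" "\<And>P. P \<in> \<P> \<Longrightarrow> p \<in> P" by blast
    \<comment> \<open>Complete regularity turns each \<open>P\<close> into a function vanishing at
      \<open>p\<close> and equal to 1 off \<open>P\<close>. Adding these functions shrinks the zero
      set into all \<open>P\<close>, hence away from \<open>A n\<close>, while keeping
      \<open>p\<close>.\<close>
    have "\<exists>f. continuous_map X euclideanreal f \<and> f p = 0 \<and> f ` (topspace X - P) \<subseteq> {1}" if "P \<in> \<P>" for P
      using cr P(2)[OF that] p(2)[OF that] unfolding completely_regular_space_alt' by blast
    then obtain h where h: "\<And>P. P \<in> \<P> \<Longrightarrow>
        continuous_map X euclideanreal (h P) \<and> h P p = (0 :: real) \<and> h P ` (topspace X - P) \<subseteq> {1}"
      by metis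
    have "|h ` \<P>| \<le>o |?I|" using P(1) card_of_image ordLeq_transitive by blast
    then have g1: "|\<G> \<union> h ` \<P>| \<le>o |?I|"
      using good inf card_of_Un_ordLeq_infinite_Field[of "|?I|" \<G> "h ` \<P>"]
      by (simp add: good_def Field_card_of card_of_card_order_on)
    have "p \<in> Zs (\<G> \<union> h ` \<P>)" using p h by (auto simp: Zs_def)
    then have g2: "Zs (\<G> \<union> h ` \<P>) \<noteq> {}" by blast
    have g3: "\<forall>g\<in>\<G> \<union> h ` \<P>. continuous_map X euclideanreal g"
      using good h by (auto simp: good_def)
    have good': "good (\<G> \<union> h ` \<P>)" unfolding good_def by (intro conjI g1 g2 g3)
    have "z \<in> P" if "z \<in> Zs (\<G> \<union> h ` \<P>)" "P \<in> \<P>" for z P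
    proof (rule ccontr)
      assume "z \<notin> P"
      then have "h P z \<in> {1}" using that h[of P] by (auto simp: Zs_def)
      moreover have "h P z = 0" using that by (auto simp: Zs_def)
      ultimately show False by simp
    qed
    then have "Zs (\<G> \<union> h ` \<P>) \<subseteq> Zs \<G> \<inter> \<Inter>\<P>"
      by (auto simp: Zs_def)
    with P(3) have "Zs (\<G> \<union> h ` \<P>) \<inter> A n = {}" by blast
    with good' show ?thesis by (intro exI[of _ "\<G> \<union> h ` \<P>"]) simp
  qed
  have "\<exists>\<G>. \<forall>n. good (\<G> n) \<and> (\<G> n \<subseteq> \<G> (Suc n) \<and> Zs (\<G> (Suc n)) \<inter> A n = {})"
  proof (rule dependent_nat_choice)
    show "\<exists>\<G>. good \<G>"
      using ne by (intro exI[of _ "{}"]) (simp add: good_def Zs_def card_of_empty ex_in_conv)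
  qed (use step in blast)
  then obtain \<G> where G: "\<And>n. good (\<G> n)" "\<And>n. \<G> n \<subseteq> \<G> (Suc n)" "\<And>n. Zs (\<G> (Suc n)) \<inter> A n = {}"
    by blast
  have mono: "mono \<G>" by (intro incseq_SucI G(2))
  \<comment> \<open>A finite subfamily of the union of the chain already lies in one stage, whose
    zero set is nonempty.\<close>
  have "\<exists>x\<in>topspace X. \<forall>g\<in>\<F>. g x = 0" if F: "finite \<F>" "\<F> \<subseteq> (\<Union>n. \<G> n)" for \<F>
  proof -
    have "subset.chain UNIV (range \<G>)"
      unfolding subset_chain_def
    proof (intro conjI ballI)
      fix P Q assume "P \<in> range \<G>" "Q \<in> range \<G>"
      then obtain i j where "P = \<G> i" "Q = \<G> j" by blast
      then show "P \<subseteq> Q \<or> Q \<subseteq> P" using monoD[OF mono] linear[of i j] by metis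
    qed simp
    then obtain n where "\<F> \<subseteq> \<G> n"
      using finite_subset_Union_chain[OF F, of UNIV] by blast
    then show ?thesis using G(1)[of n] by (auto simp: good_def Zs_def)
  qed
  moreover have "|\<Union>n. \<G> n| \<le>o |?I|"
    using G(1) nat inf by (intro card_of_UNION_ordLeq_infinite) (auto simp: good_def)
  moreover have "\<And>g. g \<in> (\<Union>n. \<G> n) \<Longrightarrow> continuous_map X euclideanreal g"
    using G(1) by (auto simp: good_def)
  ultimately obtain x where x: "x \<in> topspace X" "\<And>g. g \<in> (\<Union>n. \<G> n) \<Longrightarrow> g x = 0"
    using alpha_pseudocompact_common_zero[OF pc] by metis
  then obtain n where "x \<in> A n" using cov by blast
  moreover have "x \<in> Zs (\<G> (Suc n))" using x by (auto simp: Zs_def)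
  ultimately show False using G(3) by blast
qed

section \<open>Pseudocompact abelian groups\<close>

locale topological_comm_group = topological_group G T + comm_group G
  for G :: "('a, 'm) monoid_scheme" (structure) and T :: "'a topology"
begin

section \<open>Neighbourhoods of the identity and translations\<close>

definition sym_nbhd :: "'a set \<Rightarrow> bool" where
  "sym_nbhd V \<longleftrightarrow> openin T V \<and> \<one> \<in> V \<and> (\<forall>v\<in>V. inv v \<in> V)"

lemma sym_nbhd_closed: "sym_nbhd V \<Longrightarrow> v \<in> V \<Longrightarrow> v \<in> carrier G"
  using openin_subset topspace_eq_carrier unfolding sym_nbhd_def by blast

lemma continuous_map_translation: "a \<in> carrier G \<Longrightarrow> continuous_map T T (\<lambda>y. a \<otimes> y)"
  using continuous_map_compose[of T "prod_topology T T" "\<lambda>y. (a, y)" T "\<lambda>(x, y). x \<otimes> y"] continuous_mult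
  by (auto simp: o_def continuous_map_pairwise topspace_eq_carrier)

lemma openin_translation: "openin T V \<Longrightarrow> a \<in> carrier G \<Longrightarrow> openin T {y \<in> carrier G. a \<otimes> y \<in> V}"
  using openin_continuous_map_preimage[OF continuous_map_translation] topspace_eq_carrier by simp

lemma sym_nbhd_Inter:
  assumes "finite \<V>" "\<And>V. V \<in> \<V> \<Longrightarrow> sym_nbhd V"
  shows "sym_nbhd (carrier G \<inter> \<Inter>\<V>)"
  using assms
proof (induction \<V> rule: finite_induct)
  case empty
  then show ?case using openin_topspace[of T] by (simp add: sym_nbhd_def topspace_eq_carrier)
next
  case (insert V \<V>)
  then have "sym_nbhd V" "sym_nbhd (carrier G \<inter> \<Inter>\<V>)" by auto
  then have "sym_nbhd (V \<inter> (carrier G \<inter> \<Inter>\<V>))" unfolding sym_nbhd_def by blast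
  then show ?case by (simp add: Int_left_commute)
qed

lemma sym_nbhd_mult_ex:
  assumes V: "openin T V" "\<one> \<in> V"
  shows "\<exists>U. sym_nbhd U \<and> (\<forall>u\<in>U. \<forall>v\<in>U. u \<otimes> v \<in> V)"
proof -
  define P where "P = {p \<in> topspace (prod_topology T T). (\<lambda>(x, y). x \<otimes> y) p \<in> V}"
  have "openin (prod_topology T T) P"
    unfolding P_def by (rule openin_continuous_map_preimage[OF continuous_mult V(1)])
  moreover have "(\<one>, \<one>) \<in> P" using V by (simp add: P_def topspace_eq_carrier)
  ultimately obtain U1 U2 where U: "openin T U1" "openin T U2" "\<one> \<in> U1" "\<one> \<in> U2" "U1 \<times> U2 \<subseteq> P"
    unfolding openin_prod_topology_alt by metis
  define W where "W = U1 \<inter> U2"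
  have W: "openin T W" "\<one> \<in> W" "W \<subseteq> carrier G"
    using U openin_subset[OF U(1)] topspace_eq_carrier by (auto simp: W_def)
  define U where "U = W \<inter> {x \<in> topspace T. inv x \<in> W}"
  have "openin T U"
    using openin_continuous_map_preimage[OF continuous_inv W(1)] W(1) by (auto simp: U_def)
  then have "sym_nbhd U" using W by (auto simp: sym_nbhd_def U_def topspace_eq_carrier)
  moreover have "u \<otimes> v \<in> V" if "u \<in> U" "v \<in> U" for u v
    using that U(5) by (auto simp: U_def W_def P_def)
  ultimately show ?thesis by blast
qed

lemma sym_nbhd_mult4_ex:
  assumes V: "openin T V" "\<one> \<in> V"
  shows "\<exists>U. sym_nbhd U \<and> (\<forall>a\<in>U. \<forall>b\<in>U. \<forall>c\<in>U. \<forall>d\<in>U. (a \<otimes> b) \<otimes> (c \<otimes> d) \<in> V)"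
proof -
  obtain W where W: "sym_nbhd W" "\<forall>u\<in>W. \<forall>v\<in>W. u \<otimes> v \<in> V"
    using sym_nbhd_mult_ex[OF V] by blast
  then obtain U where "sym_nbhd U" "\<forall>u\<in>U. \<forall>v\<in>U. u \<otimes> v \<in> W"
    using sym_nbhd_mult_ex[of W] unfolding sym_nbhd_def by blast
  with W show ?thesis by (intro exI[of _ U]) blast
qed

section \<open>Total boundedness\<close>

definition covers_group :: "'a set \<Rightarrow> 'a set \<Rightarrow> bool" where
  "covers_group F V \<longleftrightarrow> finite F \<and> F \<subseteq> carrier G \<and> (\<forall>g\<in>carrier G. \<exists>f\<in>F. inv f \<otimes> g \<in> V)"

text \<open>A failure of total boundedness yields a locally finite sequence of translates of a
  neighbourhood, and hence an unbounded continuous function supported on them.\<close>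

lemma pseudocompact_totally_bounded:
  assumes pc: "alpha_pseudocompact \<alpha> T" and ne: "Field \<alpha> \<noteq> {}" and V: "openin T V" "\<one> \<in> V"
  shows "\<exists>F. covers_group F V"
proof (rule ccontr)
  assume neg: "\<nexists>F. covers_group F V"
  have ex: "\<exists>g\<in>carrier G. \<forall>f\<in>F. inv f \<otimes> g \<notin> V" if "finite F" "F \<subseteq> carrier G" for F
  proof (rule ccontr)
    assume "\<not> ?thesis"
    then have "covers_group F V" using that by (auto simp: covers_group_def)
    with neg show False by blast
  qed
  \<comment> \<open>Four factors are needed: if \<open>y U\<close> meets both \<open>x m U\<close>
    and \<open>x n U\<close>, then \<open>inv (x m) \<otimes> x n\<close> is a product of four
    elements of the symmetric set \<open>U\<close>.\<close>
  obtain U where U: "sym_nbhd U"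
    "\<forall>a\<in>U. \<forall>b\<in>U. \<forall>c\<in>U. \<forall>d\<in>U. (a \<otimes> b) \<otimes> (c \<otimes> d) \<in> V"
    using sym_nbhd_mult4_ex[OF V] by blast
  \<comment> \<open>Greedy choice: \<open>E n\<close> is the set of the first \<open>n\<close>
    points, and \<open>x n\<close> avoids all translates of \<open>V\<close> centred at
    them.\<close>
  define step where "step = (\<lambda>F. SOME g. g \<in> carrier G \<and> (\<forall>f\<in>F. inv f \<otimes> g \<notin> V))"
  define E where "E = rec_nat {} (\<lambda>_ F. insert (step F) F)"
  define x where "x n = step (E n)" for n
  have ESuc: "E (Suc n) = insert (x n) (E n)" for n by (simp add: E_def x_def)
  have step: "step F \<in> carrier G \<and> (\<forall>f\<in>F. inv f \<otimes> step F \<notin> V)" if "finite F" "F \<subseteq> carrier G" for F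
    unfolding step_def by (rule someI_ex) (use ex[OF that] in blast)
  have E: "finite (E n) \<and> E n \<subseteq> carrier G" for n
  proof (induction n)
    case (Suc n)
    then show ?case using step[of "E n"] by (simp add: ESuc x_def)
  qed (simp add: E_def)
  have xc: "x n \<in> carrier G" for n using E step by (simp add: x_def)
  have EU: "E n = x ` {..<n}" for n
    by (induction n) (simp_all add: ESuc lessThan_Suc, simp add: E_def)
  have xV: "inv (x m) \<otimes> x n \<notin> V" if "m < n" for m n
    using step[of "E n"] E[of n] that by (simp add: EU x_def[of n])
  \<comment> \<open>Local finiteness: the neighbourhood \<open>y U\<close> of \<open>y\<close> meets
    at most one of the sets \<open>x n U\<close>. The case \<open>m < n\<close> suffices by
    symmetry.\<close>
  have unique: "m = n" if y: "y \<in> carrier G" and u: "u \<in> U" "v \<in> U"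
      and xm: "inv (x m) \<otimes> (y \<otimes> u) \<in> U" and xn: "inv (x n) \<otimes> (y \<otimes> v) \<in> U" for y u v m n
  proof -
    have *: "\<not> m < n" if u: "u \<in> U" "v \<in> U"
      and xm: "inv (x m) \<otimes> (y \<otimes> u) \<in> U" and xn: "inv (x n) \<otimes> (y \<otimes> v) \<in> U" for u v m n
    proof
      assume "m < n"
      let ?a = "inv (x m) \<otimes> (y \<otimes> u)" and ?b = "inv (x n) \<otimes> (y \<otimes> v)"
      have c: "u \<in> carrier G" "v \<in> carrier G" using u U(1) sym_nbhd_closed by auto
      have "inv u \<in> U" "inv ?b \<in> U" using u xn U(1) by (auto simp: sym_nbhd_def)
      then have "(?a \<otimes> inv u) \<otimes> (v \<otimes> inv ?b) \<in> V" using U(2) xm u by blast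
      also have "(?a \<otimes> inv u) \<otimes> (v \<otimes> inv ?b) = inv (x m) \<otimes> x n"
      proof -
        have "?a \<otimes> inv u = inv (x m) \<otimes> y"
          using c y xc by (simp add: m_assoc)
        moreover have "v \<otimes> inv ?b = inv y \<otimes> x n"
        proof -
          have "inv ?b = inv v \<otimes> (inv y \<otimes> x n)"
            using c y xc by (simp add: inv_mult m_ac)
          then show ?thesis using c y xc by (simp add: m_assoc[symmetric])
        qed
        ultimately show ?thesis using c y xc by (simp add: m_assoc inv_solve_left)
      qed
      finally show False using xV[OF \<open>m < n\<close>] by simp
    qed
    show ?thesis using *[OF u xm xn] *[OF u(2) u(1) xn xm] by simp
  qed
  have "openin T U" "\<one> \<in> U" using U(1) by (auto simp: sym_nbhd_def)
  then obtain g :: "'a \<Rightarrow> real" where g: "continuous_map T euclideanreal g" "g \<one> = 0" "g ` (topspace T - U) \<subseteq> {1}"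
    using tychonov unfolding tychonov_space_def completely_regular_space_alt' by blast
  \<comment> \<open>A bump of height \<open>n\<close> on \<open>x n U\<close>, and 0 off these sets.
    The choice of \<open>n\<close> is forced by \<open>unique\<close>.\<close>
  define f where "f y = (if \<exists>n. inv (x n) \<otimes> y \<in> U
      then let n = SOME n. inv (x n) \<otimes> y \<in> U in real n * (1 - g (inv (x n) \<otimes> y)) else 0)" for y
  have f1: "f y = real n * (1 - g (inv (x n) \<otimes> y))" if "y \<in> carrier G" "inv (x n) \<otimes> y \<in> U" for y n
  proof -
    have "k = n" if "inv (x k) \<otimes> y \<in> U" for k
      using unique[of y \<one> \<one> k n] that \<open>y \<in> carrier G\<close> \<open>inv (x n) \<otimes> y \<in> U\<close> \<open>\<one> \<in> U\<close> by simp
    then have "(SOME n. inv (x n) \<otimes> y \<in> U) = n" using that(2) by (metis someI_ex)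
    then show ?thesis using that(2) by (auto simp: f_def)
  qed
  have f0: "f y = 0" if "\<And>n. inv (x n) \<otimes> y \<notin> U" for y using that by (simp add: f_def)
  have gU: "g z = 1" if "z \<in> carrier G" "z \<notin> U" for z
    using g(3) that by (auto simp: topspace_eq_carrier)
  have "continuous_map T euclideanreal f"
  \<comment> \<open>On each open set \<open>y U\<close> the function is either 0 or given by the
    formula of a single bump, which is valid beyond \<open>x n U\<close> because \<open>g\<close> is
    1 off \<open>U\<close>.\<close>
  proof (rule pasting_lemma[where I = "carrier G" and T = "\<lambda>y. {z \<in> carrier G. inv y \<otimes> z \<in> U}" and f = "\<lambda>_. f"])
    fix y assume y: "y \<in> carrier G"
    let ?W = "{z \<in> carrier G. inv y \<otimes> z \<in> U}"
    show "openin T ?W" by (rule openin_translation) (use U y in \<open>auto simp: sym_nbhd_def\<close>)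
    show "continuous_map (subtopology T ?W) euclideanreal f"
    proof (cases "\<exists>n. \<exists>z\<in>?W. inv (x n) \<otimes> z \<in> U")
      case True
      then obtain n z where z: "z \<in> ?W" "inv (x n) \<otimes> z \<in> U" by blast
      have W: "y \<otimes> (inv y \<otimes> w) = w" if "w \<in> ?W" for w using that y by (simp add: m_assoc[symmetric])
      have n: "k = n" if "w \<in> ?W" "inv (x k) \<otimes> w \<in> U" for w k
        using unique[OF y, of "inv y \<otimes> w" "inv y \<otimes> z" k n] that z W by simp
      have eq: "f w = real n * (1 - g (inv (x n) \<otimes> w))" if "w \<in> ?W" for w
      proof (cases "inv (x n) \<otimes> w \<in> U")
        case True
        then show ?thesis using f1 that by simp
      next
        case False
        then have "f w = 0" using f0 n that by metis
        moreover have "g (inv (x n) \<otimes> w) = 1" using gU False that xc by simp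
        ultimately show ?thesis by simp
      qed
      have "continuous_map T euclideanreal (\<lambda>w. real n * (1 - g (inv (x n) \<otimes> w)))"
        using continuous_map_compose[OF continuous_map_translation g(1), of "inv (x n)"] xc
        by (intro continuous_map_real_mult continuous_map_diff) (auto simp: o_def)
      then have "continuous_map (subtopology T ?W) euclideanreal (\<lambda>w. real n * (1 - g (inv (x n) \<otimes> w)))"
        by (rule continuous_map_from_subtopology)
      then show ?thesis by (rule continuous_map_eq) (use eq in auto)
    next
      case False
      have "continuous_map (subtopology T ?W) euclideanreal (\<lambda>_. 0)" by simp
      then show ?thesis by (rule continuous_map_eq) (use False f0 in auto)
    qed
  next
    show "\<exists>j. j \<in> carrier G \<and> y \<in> {z \<in> carrier G. inv j \<otimes> z \<in> U} \<and> f y = f y" if "y \<in> topspace T" for y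
      using that \<open>\<one> \<in> U\<close> by (intro exI[of _ y]) (simp add: topspace_eq_carrier)
  qed simp
  then obtain B where B: "\<And>y. y \<in> topspace T \<Longrightarrow> \<bar>f y\<bar> \<le> B"
    using alpha_pseudocompact_bounded[OF pc ne] by blast
  have "real n \<le> B" for n
    using B[of "x n"] f1[of "x n" n] xc[of n] \<open>\<one> \<in> U\<close> g(2) by (simp add: topspace_eq_carrier)
  then show False by (meson not_le reals_Archimedean2)
qed

section \<open>Disjoint translates and the countable chain condition\<close>

definition double_translate :: "'a \<times> 'a set \<Rightarrow> 'a set" where
  "double_translate p = {fst p \<otimes> (u \<otimes> v) |u v. u \<in> snd p \<and> v \<in> snd p}"

lemma double_translateI: "u \<in> V \<Longrightarrow> v \<in> V \<Longrightarrow> x \<otimes> (u \<otimes> v) \<in> double_translate (x, V)"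
  unfolding double_translate_def by auto

text \<open>With Haar measure this would say that each \<open>V\<close> has measure at least \<open>1 / k\<close>; instead,
  the number of translates of a small \<open>W\<close> needed to cover a set serves as the measure.\<close>

lemma card_disjoint_translates_le:
  assumes tb: "\<And>V. openin T V \<Longrightarrow> \<one> \<in> V \<Longrightarrow> \<exists>F. covers_group F V"
    and fin: "finite M" and M: "\<And>x V. (x, V) \<in> M \<Longrightarrow> x \<in> carrier G \<and> sym_nbhd V"
    and cov: "\<And>x V. (x, V) \<in> M \<Longrightarrow> \<exists>F. covers_group F V \<and> card F \<le> k"
    and dis: "pairwise (\<lambda>p q. disjnt (double_translate p) (double_translate q)) M"
  shows "card M \<le> k"
proof -
  define W where "W = carrier G \<inter> \<Inter>(snd ` M)"
  have W: "sym_nbhd W" unfolding W_def by (rule sym_nbhd_Inter) (use fin M in auto)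
  have WM: "W \<subseteq> V" if "(x, V) \<in> M" for x V using that by (force simp: W_def)
  have "\<exists>C. covers_group C W" using tb W by (auto simp: sym_nbhd_def)
  \<comment> \<open>The cardinality of a minimal cover is the covering number of \<open>G\<close> by
    translates of \<open>W\<close>.\<close>
  then obtain C where C: "covers_group C W" and Cmin: "\<And>C'. covers_group C' W \<Longrightarrow> card C \<le> card C'"
    using ex_has_least_nat[of "\<lambda>C. covers_group C W" _ card] by blast
  have Cfin: "finite C" "C \<subseteq> carrier G" using C by (auto simp: covers_group_def)
  have "C \<noteq> {}" using C one_closed unfolding covers_group_def by blast
  then have Cpos: "card C > 0" using Cfin by (simp add: card_gt_0_iff)
  define N where "N p = C \<inter> double_translate p" for p
  have key: "card C \<le> k * card (N p)" if pM: "p \<in> M" for p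
  proof -
    obtain x V where p: "p = (x, V)" by (cases p)
    have x: "x \<in> carrier G" and V: "sym_nbhd V" using M pM p by auto
    obtain F where F: "covers_group F V" "card F \<le> k" using cov pM p by blast
    \<comment> \<open>Points of \<open>x V\<close> are covered by translates of \<open>W\<close>
      centred at points of \<open>C\<close> in \<open>x V V\<close>, that is, in \<open>N p\<close>.
      Moving \<open>x V\<close> onto the at most \<open>k\<close> translates \<open>f V\<close>
      covers all of \<open>G\<close>, and minimality of \<open>C\<close> bounds its size.\<close>
    let ?C = "(\<lambda>(f, y). f \<otimes> inv x \<otimes> y) ` (F \<times> N p)"
    have Fc: "finite F" "F \<subseteq> carrier G" using F by (auto simp: covers_group_def)
    have NC: "finite (N p)" "N p \<subseteq> carrier G" using Cfin by (auto simp: N_def)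
    have "covers_group ?C W"
      unfolding covers_group_def
    proof (intro conjI ballI)
      show "finite ?C" using Fc NC by simp
      show "?C \<subseteq> carrier G" using Fc NC x by auto
      fix g assume g: "g \<in> carrier G"
      then obtain f where f: "f \<in> F" "inv f \<otimes> g \<in> V" using F(1) by (auto simp: covers_group_def)
      then have fc: "f \<in> carrier G" using Fc by blast
      let ?h = "x \<otimes> (inv f \<otimes> g)"
      have h: "?h \<in> carrier G" using x fc g by simp
      then obtain y where y: "y \<in> C" "inv y \<otimes> ?h \<in> W" using C by (auto simp: covers_group_def)
      then have yc: "y \<in> carrier G" using Cfin by blast
      have "inv (inv y \<otimes> ?h) \<in> W" using W y(2) by (simp add: sym_nbhd_def)
      then have "inv (inv y \<otimes> ?h) \<in> V" using WM pM p by blast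
      moreover have "x \<otimes> ((inv f \<otimes> g) \<otimes> inv (inv y \<otimes> ?h)) = y"
      proof -
        have "x \<otimes> ((inv f \<otimes> g) \<otimes> inv (inv y \<otimes> ?h)) = ?h \<otimes> inv (inv y \<otimes> ?h)"
          using x fc g yc h by (simp add: m_assoc)
        also have "\<dots> = ?h \<otimes> (inv ?h \<otimes> y)"
          using inv_mult_group[OF inv_closed[OF yc] h] yc by simp
        also have "\<dots> = y" using m_assoc[OF h inv_closed[OF h] yc] r_inv[OF h] yc by simp
        finally show ?thesis .
      qed
      ultimately have "y \<in> double_translate p"
        unfolding p using double_translateI[OF f(2)] by metis
      then have yN: "y \<in> N p" using y by (simp add: N_def)
      have "inv (f \<otimes> inv x \<otimes> y) \<otimes> g = inv y \<otimes> ?h"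
        using fc x yc g by (simp add: inv_mult m_ac)
      then show "\<exists>c\<in>?C. inv c \<otimes> g \<in> W" using y(2) f(1) yN by force
    qed
    then have "card C \<le> card ?C" by (rule Cmin)
    also have "\<dots> \<le> card (F \<times> N p)" by (rule card_image_le) (use Fc NC in simp)
    also have "\<dots> \<le> k * card (N p)" using F(2) by (simp add: card_cartesian_product)
    finally show ?thesis .
  qed
  \<comment> \<open>Disjointness makes the sets \<open>N p\<close> disjoint subsets of
    \<open>C\<close>, so summing \<open>key\<close> and cancelling \<open>card C\<close> leaves the
    bound.\<close>
  have "card M * card C = (\<Sum>p\<in>M. card C)" by simp
  also have "\<dots> \<le> (\<Sum>p\<in>M. k * card (N p))" by (rule sum_mono) (rule key)
  also have "\<dots> = k * card (\<Union>p\<in>M. N p)"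
  proof -
    have "card (\<Union>p\<in>M. N p) = (\<Sum>p\<in>M. card (N p))"
    proof (rule card_UN_disjoint[OF fin])
      show "\<forall>p\<in>M. finite (N p)" using Cfin by (simp add: N_def)
      show "\<forall>p\<in>M. \<forall>q\<in>M. p \<noteq> q \<longrightarrow> N p \<inter> N q = {}"
        using dis unfolding pairwise_def disjnt_def N_def by blast
    qed
    then show ?thesis by (simp add: sum_distrib_left)
  qed
  also have "\<dots> \<le> k * card C"
    by (intro mult_left_mono card_mono Cfin) (auto simp: N_def)
  finally show ?thesis using Cpos by simp
qed

text \<open>A maximal disjoint family of sets \<open>x V V\<close> with \<open>x V V V\<close>
  inside \<open>A\<close> is countable. Its sets \<open>V\<close> suffice: a displacement lying in
  all of them keeps every member of the family inside \<open>A\<close>, and by maximality the family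
  comes near each point of the closure.\<close>

lemma closure_of_open_invariant:
  assumes tb: "\<And>V. openin T V \<Longrightarrow> \<one> \<in> V \<Longrightarrow> \<exists>F. covers_group F V" and A: "openin T A"
  shows "\<exists>\<V>. countable \<V> \<and> (\<forall>V\<in>\<V>. openin T V \<and> \<one> \<in> V) \<and>
    (\<forall>x\<in>T closure_of A. \<forall>d\<in>carrier G. (\<forall>V\<in>\<V>. inv x \<otimes> d \<in> V) \<longrightarrow> d \<in> T closure_of A)"
proof -
  \<comment> \<open>The third factor \<open>w\<close> reserves room inside \<open>A\<close> for the
    displacement \<open>inv x \<otimes> d\<close>.\<close>
  define P where "P = {p. fst p \<in> carrier G \<and> sym_nbhd (snd p) \<and>
     (\<forall>u\<in>snd p. \<forall>v\<in>snd p. \<forall>w\<in>snd p. fst p \<otimes> (u \<otimes> v) \<otimes> w \<in> A)}"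
  let ?R = "\<lambda>p q. disjnt (double_translate p) (double_translate q)"
  let ?\<S> = "{M. M \<subseteq> P \<and> pairwise ?R M}"
  have "\<exists>M\<in>?\<S>. \<forall>X\<in>?\<S>. M \<subseteq> X \<longrightarrow> X = M"
  proof (rule subset_Zorn_nonempty)
    show "?\<S> \<noteq> {}" by (auto intro: exI[of _ "{}"])
    fix \<C> assume ne: "\<C> \<noteq> {}" and ch: "subset.chain ?\<S> \<C>"
    then have "\<Union>\<C> \<subseteq> P" by (auto simp: subset_chain_def)
    moreover have "pairwise ?R (\<Union>\<C>)"
    proof (rule pairwiseI)
      fix p q assume pq: "p \<in> \<Union>\<C>" "q \<in> \<Union>\<C>" "p \<noteq> q"
      then have "finite {p, q}" "{p, q} \<subseteq> \<Union>\<C>" by auto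
      then obtain M where "M \<in> \<C>" "{p, q} \<subseteq> M" using finite_subset_Union_chain ne ch by meson
      moreover from this have "pairwise ?R M" using ch by (auto simp: subset_chain_def)
      ultimately show "?R p q" using pq(3) by (auto simp: pairwise_def)
    qed
    ultimately show "\<Union>\<C> \<in> ?\<S>" by blast
  qed
  then obtain M where MP: "M \<subseteq> P" and dis: "pairwise ?R M"
    and max: "\<And>X. X \<subseteq> P \<Longrightarrow> pairwise ?R X \<Longrightarrow> M \<subseteq> X \<Longrightarrow> X = M" by auto
  \<comment> \<open>Covering numbers stratify \<open>M\<close>:
    \<open>card_disjoint_translates_le\<close> leaves at most \<open>k\<close> members in
    \<open>Mk k\<close>, and total boundedness puts every member in some
    \<open>Mk k\<close>.\<close>
  define Mk where "Mk k = {p \<in> M. \<exists>F. covers_group F (snd p) \<and> card F \<le> k}" for k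
  have "finite (Mk k)" for k
  proof (rule ccontr)
    assume "infinite (Mk k)"
    then obtain S where S: "finite S" "card S = Suc k" "S \<subseteq> Mk k"
      using infinite_arbitrarily_large by blast
    have "card S \<le> k"
    proof (rule card_disjoint_translates_le[OF tb S(1)])
      show "x \<in> carrier G \<and> sym_nbhd V" if "(x, V) \<in> S" for x V
        using that S(3) MP by (auto simp: Mk_def P_def)
      show "\<exists>F. covers_group F V \<and> card F \<le> k" if "(x, V) \<in> S" for x V
        using subsetD[OF S(3) that] by (simp add: Mk_def)
      show "pairwise ?R S" using dis S(3) by (auto intro: pairwise_subset simp: Mk_def)
    qed
    with S(2) show False by simp
  qed
  moreover have "M \<subseteq> (\<Union>k. Mk k)"
  proof
    fix p assume p: "p \<in> M"
    then have "sym_nbhd (snd p)" using MP by (auto simp: P_def)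
    then obtain F where "covers_group F (snd p)" using tb by (auto simp: sym_nbhd_def)
    with p have "p \<in> Mk (card F)" by (auto simp: Mk_def)
    then show "p \<in> (\<Union>k. Mk k)" by blast
  qed
  ultimately have "countable M"
    by (meson countable_UN countable_finite countable_subset uncountable_def countableI_type)
  then have c: "countable (snd ` M)" by simp
  have o: "openin T V \<and> \<one> \<in> V" if "V \<in> snd ` M" for V
    using that MP by (auto simp: P_def sym_nbhd_def)
  have inv: "d \<in> T closure_of A"
    if x: "x \<in> T closure_of A" and d: "d \<in> carrier G" and xd: "\<And>V. V \<in> snd ` M \<Longrightarrow> inv x \<otimes> d \<in> V" for x d
    unfolding in_closure_of
  proof (intro conjI allI impI)
    show "d \<in> topspace T" using d by (simp add: topspace_eq_carrier)
    have xc: "x \<in> carrier G" using x by (simp add: in_closure_of topspace_eq_carrier)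
    fix Q assume Q: "d \<in> Q \<and> openin T Q"
    let ?h = "inv x \<otimes> d"
    have h: "?h \<in> carrier G" using xc d by simp
    \<comment> \<open>The neighbourhood \<open>Q\<close> of \<open>d\<close> pulled back to a
      neighbourhood of \<open>x\<close>, where points of \<open>A\<close> are available.\<close>
    define R where "R = {y \<in> carrier G. ?h \<otimes> y \<in> Q}"
    have R: "openin T R" unfolding R_def using openin_translation Q h by simp
    moreover have "x \<in> R" using Q xc d by (simp add: R_def m_ac)
    ultimately obtain a where a: "a \<in> A" "a \<in> R" using x unfolding in_closure_of by metis
    then have ac: "a \<in> carrier G" by (simp add: R_def)
    define N where "N = {y \<in> carrier G. a \<otimes> y \<in> R \<inter> A}"
    have N: "openin T N" unfolding N_def by (intro openin_translation openin_Int R A ac)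
    have "\<one> \<in> N" using a ac by (simp add: N_def)
    with N obtain V where V: "sym_nbhd V"
      "\<forall>u\<in>V. \<forall>v\<in>V. \<forall>w\<in>V. \<forall>z\<in>V. (u \<otimes> v) \<otimes> (w \<otimes> z) \<in> N"
      using sym_nbhd_mult4_ex by metis
    have V1: "\<one> \<in> V" and Vc: "\<And>v. v \<in> V \<Longrightarrow> v \<in> carrier G"
      using V(1) sym_nbhd_closed by (auto simp: sym_nbhd_def)
    have V3: "a \<otimes> (u \<otimes> v) \<otimes> w \<in> R \<inter> A" if "u \<in> V" "v \<in> V" "w \<in> V" for u v w
    proof -
      have "(u \<otimes> v) \<otimes> (w \<otimes> \<one>) \<in> N" using V(2) V1 that by blast
      then show ?thesis using that Vc ac by (simp add: N_def m_assoc)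
    qed
    have VP: "(a, V) \<in> P" using V(1) ac V3 by (simp add: P_def)
    have ne: "a \<in> double_translate (a, V)"
      unfolding double_translate_def using V1 ac by (auto intro!: exI[of _ \<one>])
    \<comment> \<open>By maximality the small set around \<open>a\<close> cannot be disjoint from
      every member of \<open>M\<close>. A common point \<open>z\<close>, displaced by
      \<open>?h\<close>, lies in \<open>Q\<close> because \<open>z\<close> is in \<open>R\<close>,
      and in \<open>A\<close> because \<open>?h\<close> is in \<open>snd q\<close>.\<close>
    obtain q where q: "q \<in> M" "\<not> disjnt (double_translate (a, V)) (double_translate q)"
    proof (cases "(a, V) \<in> M")
      case True
      then show ?thesis using that ne by (metis disjnt_iff)
    next
      case False
      then have "insert (a, V) M \<noteq> M" by blast
      then have "\<not> pairwise ?R (insert (a, V) M)" using max[of "insert (a, V) M"] VP MP by blast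
      then show ?thesis using that dis by (auto simp: pairwise_insert disjnt_sym)
    qed
    then obtain z where z: "z \<in> double_translate (a, V)" "z \<in> double_translate q" by (auto simp: disjnt_iff)
    from z(1) obtain u v where "u \<in> V" "v \<in> V" "z = a \<otimes> (u \<otimes> v)" by (auto simp: double_translate_def)
    then have "z \<in> R" using V3[of u v \<one>] V1 Vc ac by simp
    then have zO: "z \<otimes> ?h \<in> Q" using h m_comm[of z ?h] by (simp add: R_def)
    from z(2) obtain u v where uv: "u \<in> snd q" "v \<in> snd q" "z = fst q \<otimes> (u \<otimes> v)" by (auto simp: double_translate_def)
    have "?h \<in> snd q" using xd q(1) by blast
    then have "z \<otimes> ?h \<in> A" using uv MP q(1) by (auto simp: P_def)
    with zO show "\<exists>y. y \<in> A \<and> y \<in> Q" by blast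
  qed
  show ?thesis
  proof (intro exI[of _ "snd ` M"] conjI ballI impI)
    show "d \<in> T closure_of A"
      if "x \<in> T closure_of A" "d \<in> carrier G" "\<forall>V\<in>snd ` M. inv x \<otimes> d \<in> V" for x d
      using inv[OF that(1,2)] that(3) by simp
  qed (use c o in simp_all)
qed

section \<open>Extending continuous maps from dense subsets\<close>

abbreviation cl :: "'a set \<Rightarrow> 'a set" where
  "cl S \<equiv> T closure_of S"

text \<open>Every point \<open>x\<close> has a companion \<open>e x \<in> D\<close> lying in the closures of the same sublevel and
  superlevel sets of the coordinates of \<open>f\<close>; then \<open>f (e x)\<close> is the limit of \<open>f\<close> at \<open>x\<close>.\<close>

lemma alpha_pseudocompact_dense_subset:
  assumes tb: "\<And>V. openin T V \<Longrightarrow> \<one> \<in> V \<Longrightarrow> \<exists>F. covers_group F V"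
    and pc: "alpha_pseudocompact \<alpha> T" and inf: "infinite (Field \<alpha>)"
    and D: "card_dense_in (Field \<alpha>) T D"
  shows "alpha_pseudocompact \<alpha> (subtopology T D)"
  unfolding alpha_pseudocompact_def
proof (intro allI impI)
  let ?I = "Field \<alpha>" and ?P = "powertop_real (Field \<alpha>)"
  fix f assume f: "continuous_map (subtopology T D) ?P f"
  have DG: "D \<subseteq> topspace T" using D by (simp add: card_dense_in_def)
  have closure: "cl D = topspace T" by (rule card_dense_in_closure_of[OF D inf])
  have fP: "f y \<in> topspace ?P" if "y \<in> D" for y
    using continuous_map_image_subset_topspace[OF f] that DG by auto
  have fi: "continuous_map (subtopology T D) euclideanreal (\<lambda>y. f y i)" if "i \<in> ?I" for i
    using f that by (simp add: continuous_map_componentwise)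
  \<comment> \<open>Open half-lines with rational endpoints: the Boolean selects the side. Countably
    many suffice to control limits in one coordinate.\<close>
  define H where "H = (\<lambda>(q :: rat, s). if s then {..<of_rat q} else {of_rat q<..} :: real set)"
  have "open (H p)" for p by (cases p) (simp add: H_def)
  have preim: "\<exists>A. openin T A \<and> {y \<in> D. f y i \<in> S} = D \<inter> A" if "i \<in> ?I" "open S" for i and S :: "real set"
  proof -
    have "openin (subtopology T D) {y \<in> topspace (subtopology T D). f y i \<in> S}"
      using openin_continuous_map_preimage[OF fi[OF that(1)]] that(2) by simp
    moreover have "{y \<in> topspace (subtopology T D). f y i \<in> S} = {y \<in> D. f y i \<in> S}" using DG by auto
    ultimately show ?thesis unfolding openin_subtopology by auto
  qed
  have "\<exists>A. openin T A \<and> {y \<in> D. f y (fst j) \<in> H (snd j)} = D \<inter> A" if "j \<in> ?I \<times> UNIV" for j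
    using preim that \<open>\<And>p. open (H p)\<close> by auto
  then obtain A where A: "\<And>j. j \<in> ?I \<times> UNIV \<Longrightarrow>
      openin T (A j) \<and> {y \<in> D. f y (fst j) \<in> H (snd j)} = D \<inter> A j"
    by metis
  define Q where "Q j \<V> \<longleftrightarrow> countable \<V> \<and> (\<forall>V\<in>\<V>. openin T V \<and> \<one> \<in> V) \<and>
    (\<forall>x\<in>cl (A j). \<forall>d\<in>carrier G. (\<forall>V\<in>\<V>. inv x \<otimes> d \<in> V) \<longrightarrow> d \<in> cl (A j))" for j \<V>
  have "\<exists>\<V>. Q j \<V>" if "j \<in> ?I \<times> UNIV" for j
    unfolding Q_def by (rule closure_of_open_invariant) (use tb A that in auto)
  then obtain \<V> where Q: "\<And>j. j \<in> ?I \<times> UNIV \<Longrightarrow> Q j (\<V> j)" by metis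
  have V: "countable (\<V> j)" "\<And>V. V \<in> \<V> j \<Longrightarrow> openin T V \<and> \<one> \<in> V"
      "\<And>x d. x \<in> cl (A j) \<Longrightarrow> d \<in> carrier G \<Longrightarrow> (\<And>V. V \<in> \<V> j \<Longrightarrow> inv x \<otimes> d \<in> V) \<Longrightarrow> d \<in> cl (A j)"
    if "j \<in> ?I \<times> UNIV" for j
    using Q[OF that] by (auto simp: Q_def)
  \<comment> \<open>One countable family for each coordinate and half-line, hence at most
    \<open>|\<alpha>|\<close> neighbourhoods in all; density of \<open>D\<close> handles them
    simultaneously.\<close>
  define \<W> where "\<W> = (\<Union>j\<in>?I \<times> UNIV. \<V> j)"
  have "|?I \<times> (UNIV :: (rat \<times> bool) set)| \<le>o |?I|"
    using inf card_of_countable_ordLeq[OF _ inf, of "UNIV :: (rat \<times> bool) set"]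
      card_of_mono1[of ?I ?I]
    by (intro card_of_Sigma_ordLeq_infinite) auto
  then have W: "|\<W>| \<le>o |?I|"
    unfolding \<W>_def using inf V(1) card_of_countable_ordLeq[OF _ inf]
    by (intro card_of_UNION_ordLeq_infinite) auto
  have companion: "\<exists>d\<in>D. \<forall>j\<in>?I \<times> UNIV. x \<in> cl (A j) \<longrightarrow> d \<in> cl (A j)"
    if x: "x \<in> carrier G" for x
  proof -
    let ?tr = "\<lambda>V. {y \<in> carrier G. inv x \<otimes> y \<in> V}"
    have c: "|?tr ` \<W>| \<le>o |?I|" using W card_of_image ordLeq_transitive by blast
    have o: "openin T U" if U: "U \<in> ?tr ` \<W>" for U
    proof -
      obtain V where "V \<in> \<W>" "U = ?tr V" using U by blast
      moreover from this have "openin T V" using V(2) by (auto simp: \<W>_def)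
      ultimately show ?thesis using openin_translation[of V "inv x"] x by simp
    qed
    have xU: "x \<in> U" if "U \<in> ?tr ` \<W>" for U
      using that V(2) x by (auto simp: \<W>_def)
    have xT: "x \<in> topspace T" using x by (simp add: topspace_eq_carrier)
    obtain d where d: "d \<in> D" "\<And>U. U \<in> ?tr ` \<W> \<Longrightarrow> d \<in> U"
      using card_dense_inD[OF D c o xT xU] by blast
    have dc: "d \<in> carrier G" using d(1) DG topspace_eq_carrier by blast
    have "inv x \<otimes> d \<in> V" if "V \<in> \<V> j" "j \<in> ?I \<times> UNIV" for V j
    proof -
      have "V \<in> \<W>" using that by (auto simp: \<W>_def)
      then have "d \<in> ?tr V" using d(2) by blast
      then show ?thesis by simp
    qed
    then show ?thesis using d(1) V(3) dc by blast
  qed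
  have lim: "limitin ?P f (f d) (atin_within T x D)"
    if x: "x \<in> carrier G" and d: "d \<in> D"
      and cl: "\<And>j. j \<in> ?I \<times> UNIV \<Longrightarrow> x \<in> cl (A j) \<Longrightarrow> d \<in> cl (A j)" for x d
    unfolding limitin_componentwise
  proof (intro conjI ballI)
    show "f d \<in> extensional ?I" using fP[OF d] by (simp add: PiE_iff)
    show "eventually (\<lambda>y. f y \<in> topspace ?P) (atin_within T x D)"
      unfolding eventually_atin_within using fP openin_topspace by blast
    fix i assume i: "i \<in> ?I"
    have ev: "eventually (\<lambda>y. f y i \<notin> H p) (atin_within T x D)" if S: "open S" "f d i \<in> S" "S \<inter> H p = {}" for S p
    proof -
      have j: "(i, p) \<in> ?I \<times> UNIV" using i by simp
      have Aj: "openin T (A (i, p))" "{y \<in> D. f y i \<in> H p} = D \<inter> A (i, p)" using A[OF j] by auto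
      \<comment> \<open>The preimages of \<open>S\<close> and \<open>H p\<close> are disjoint traces
        on \<open>D\<close> of open sets. Since \<open>D\<close> is dense, the open sets themselves
        are disjoint, so the one around \<open>d\<close> excludes \<open>d\<close> from the closure
        of the other.\<close>
      have "d \<notin> cl (A (i, p))"
      proof
        assume dcl: "d \<in> cl (A (i, p))"
        obtain B where B: "openin T B" "{y \<in> D. f y i \<in> S} = D \<inter> B" using preim[OF i S(1)] by blast
        have "d \<in> B" using d S(2) B(2) by blast
        then obtain a where a: "a \<in> A (i, p)" "a \<in> B" using dcl B(1) unfolding in_closure_of by blast
        then have "a \<in> topspace T" using B(1) openin_subset by blast
        then have "a \<in> cl D" using closure by simp
        moreover have "openin T (A (i, p) \<inter> B)" using Aj(1) B(1) by blast
        ultimately obtain y where "y \<in> D" "y \<in> A (i, p) \<inter> B" using a unfolding in_closure_of by blast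
        then have "f y i \<in> H p" "f y i \<in> S" using Aj(2) B(2) by blast+
        with S(3) show False by blast
      qed
      then have "x \<notin> cl (A (i, p))" using cl[OF j] by blast
      then obtain B where B: "openin T B" "x \<in> B" "\<forall>y. y \<in> A (i, p) \<longrightarrow> y \<notin> B"
        using x unfolding in_closure_of topspace_eq_carrier by blast
      then have "\<forall>y\<in>B. y \<in> D \<and> y \<noteq> x \<longrightarrow> f y i \<notin> H p" using Aj(2) by blast
      then show ?thesis unfolding eventually_atin_within using B by blast
    qed
    have "((\<lambda>y. f y i) \<longlongrightarrow> f d i) (atin_within T x D)"
    proof (rule order_tendstoI)
      fix a assume "a < f d i"
      then obtain q where q: "a < of_rat q" "of_rat q < f d i" using of_rat_dense by blast
      have "eventually (\<lambda>y. f y i \<notin> H (q, True)) (atin_within T x D)"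
        by (rule ev[of "{of_rat q<..}"]) (use q in \<open>auto simp: H_def\<close>)
      then show "eventually (\<lambda>y. a < f y i) (atin_within T x D)"
        by (rule eventually_mono) (use q in \<open>auto simp: H_def\<close>)
    next
      fix a assume "f d i < a"
      then obtain q where q: "of_rat q < a" "f d i < of_rat q" using of_rat_dense by blast
      have "eventually (\<lambda>y. f y i \<notin> H (q, False)) (atin_within T x D)"
        by (rule ev[of "{..<of_rat q}"]) (use q in \<open>auto simp: H_def\<close>)
      then show "eventually (\<lambda>y. f y i < a) (atin_within T x D)"
        by (rule eventually_mono) (use q in \<open>auto simp: H_def\<close>)
    qed
    then show "limitin euclideanreal (\<lambda>y. f y i) (f d i) (atin_within T x D)" by simp
  qed
  \<comment> \<open>For \<open>x\<close> in \<open>D\<close> the companion is \<open>x\<close>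
    itself. Thus \<open>f \<circ> e\<close> extends \<open>f\<close>, and as \<open>e\<close> has
    values in \<open>D\<close> no new values arise.\<close>
  have "\<exists>d. d \<in> D \<and> (x \<in> D \<longrightarrow> d = x) \<and> limitin ?P f (f d) (atin_within T x D)" if x: "x \<in> carrier G" for x
  proof (cases "x \<in> D")
    case True
    then show ?thesis using lim[OF x True] by blast
  next
    case False
    then show ?thesis using companion[OF x] lim[OF x] by blast
  qed
  then obtain e where e: "\<And>x. x \<in> carrier G \<Longrightarrow> e x \<in> D \<and> (x \<in> D \<longrightarrow> e x = x) \<and> limitin ?P f (f (e x)) (atin_within T x D)"
    by metis
  have reg: "regular_space ?P" by (simp add: regular_space_product_topology regular_space_euclidean)
  have "continuous_map (subtopology T (topspace T)) ?P (f \<circ> e)"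
  proof (rule continuous_map_on_intermediate_closure_of[OF reg, where S = D])
    fix t assume "t \<in> topspace T"
    then have t: "t \<in> carrier G" by (simp add: topspace_eq_carrier)
    have "f y = (f \<circ> e) y" if "y \<in> D" for y
      using e[of y] that DG topspace_eq_carrier by auto
    then have "eventually (\<lambda>y. f y = (f \<circ> e) y) (atin_within T t D)"
      unfolding eventually_atin_within using openin_topspace by blast
    moreover have "limitin ?P f ((f \<circ> e) t) (atin_within T t D)" using e[OF t] by simp
    ultimately show "limitin ?P (f \<circ> e) ((f \<circ> e) t) (atin_within T t D)"
      by (rule limitin_transform_eventually)
  qed (simp add: closure)
  then have "compactin ?P ((f \<circ> e) ` topspace T)"
    using pc unfolding alpha_pseudocompact_def subtopology_topspace by blast
  moreover have "(f \<circ> e) ` topspace T = f ` topspace (subtopology T D)"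
  proof
    show "(f \<circ> e) ` topspace T \<subseteq> f ` topspace (subtopology T D)"
      using e DG by (auto simp: topspace_eq_carrier)
    show "f ` topspace (subtopology T D) \<subseteq> (f \<circ> e) ` topspace T"
    proof
      fix t assume "t \<in> f ` topspace (subtopology T D)"
      then obtain y where y: "y \<in> D" "y \<in> topspace T" "t = f y" by auto
      then have "e y = y" using e[of y] by (simp add: topspace_eq_carrier)
      then show "t \<in> (f \<circ> e) ` topspace T" using y by (auto intro!: image_eqI[of _ _ y])
    qed
  qed
  ultimately show "compactin ?P (f ` topspace (subtopology T D))" by simp
qed

section \<open>Dense subgroups from countable covers\<close>

text \<open>By the Baire argument some \<open>A n\<close> is dense in an intersection
  \<open>Z\<close> of open sets. Translates of \<open>Z\<close> by elements
  \<open>f \<otimes> inv a\<close> with \<open>f\<close> in a small set \<open>F\<close> and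
  \<open>a\<close> in \<open>A n\<close> cover the group, and a subgroup containing \<open>F\<close>
  and \<open>A n\<close> is dense in each translate.\<close>

lemma card_dense_subgroups_of_cover:
  fixes A :: "nat \<Rightarrow> 'a set"
  assumes tb: "\<And>V. openin T V \<Longrightarrow> \<one> \<in> V \<Longrightarrow> \<exists>F. covers_group F V"
    and pc: "alpha_pseudocompact \<alpha> T" and inf: "infinite (Field \<alpha>)"
    and cov: "carrier G \<subseteq> (\<Union>n. A n)"
  shows "\<exists>n F. F \<subseteq> carrier G \<and> |F| \<le>o |Pow (Field \<alpha>)| \<and>
    (\<forall>D. subgroup D G \<longrightarrow> A n \<subseteq> D \<longrightarrow> F \<subseteq> D \<longrightarrow> card_dense_in (Field \<alpha>) T D)"
proof -
  let ?I = "Field \<alpha>"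
  have cr: "completely_regular_space T" using tychonov by (simp add: tychonov_space_def)
  have ne: "topspace T \<noteq> {}" using one_closed unfolding topspace_eq_carrier by blast
  have cov': "topspace T \<subseteq> (\<Union>n. A n)" using cov by (simp add: topspace_eq_carrier)
  obtain n \<U> where U: "|\<U>| \<le>o |?I|" "\<And>U. U \<in> \<U> \<Longrightarrow> openin T U" "topspace T \<inter> \<Inter>\<U> \<noteq> {}"
    and dense: "\<And>\<P>. |\<P>| \<le>o |?I| \<Longrightarrow> (\<And>P. P \<in> \<P> \<Longrightarrow> openin T P) \<Longrightarrow> topspace T \<inter> \<Inter>\<U> \<inter> \<Inter>\<P> \<noteq> {} \<Longrightarrow>
       A n \<inter> topspace T \<inter> \<Inter>\<U> \<inter> \<Inter>\<P> \<noteq> {}"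
    by (rule alpha_pseudocompact_Baire[OF pc inf cr ne cov']) blast
  have "A n \<inter> topspace T \<inter> \<Inter>\<U> \<inter> \<Inter>{} \<noteq> {}"
    by (rule dense) (use U(3) in \<open>simp_all add: card_of_empty\<close>)
  then obtain a where a: "a \<in> A n" "a \<in> carrier G" "\<And>U. U \<in> \<U> \<Longrightarrow> a \<in> U"
    unfolding topspace_eq_carrier by blast
  have "\<exists>V C. sym_nbhd V \<and> (\<forall>u\<in>V. \<forall>v\<in>V. a \<otimes> (u \<otimes> v) \<in> U) \<and> covers_group C V" if UU: "U \<in> \<U>" for U
  proof -
    define N where "N = {y \<in> carrier G. a \<otimes> y \<in> U}"
    have "openin T N" unfolding N_def using openin_translation U(2)[OF UU] a(2) by blast
    moreover have "\<one> \<in> N" using a(2) a(3)[OF UU] by (simp add: N_def)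
    ultimately obtain V where V: "sym_nbhd V" "\<forall>u\<in>V. \<forall>v\<in>V. u \<otimes> v \<in> N"
      using sym_nbhd_mult_ex by metis
    obtain C where C: "covers_group C V" using tb[of V] V(1) unfolding sym_nbhd_def by blast
    have "\<forall>u\<in>V. \<forall>v\<in>V. a \<otimes> (u \<otimes> v) \<in> U" using V(2) by (simp add: N_def)
    with V(1) C show ?thesis by blast
  qed
  then obtain V C where VC: "\<And>U. U \<in> \<U> \<Longrightarrow> sym_nbhd (V U)"
      "\<And>U u v. U \<in> \<U> \<Longrightarrow> u \<in> V U \<Longrightarrow> v \<in> V U \<Longrightarrow> a \<otimes> (u \<otimes> v) \<in> U"
      "\<And>U. U \<in> \<U> \<Longrightarrow> covers_group (C U) (V U)"
    by metis
  \<comment> \<open>The code of \<open>x\<close> records which of the translates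
    \<open>c V U\<close>, for \<open>U\<close> in \<open>\<U>\<close> and \<open>c\<close> in
    \<open>C U\<close>, contain \<open>x\<close>. There are at most \<open>2^\<alpha>\<close> codes,
    and \<open>F\<close> contains one point for each code that occurs.\<close>
  define code where "code x = {p \<in> Sigma \<U> C. inv (snd p) \<otimes> x \<in> V (fst p)}" for x
  define rep where "rep s = (SOME x. x \<in> carrier G \<and> code x = s)" for s
  define F where "F = rep ` code ` carrier G"
  have rep: "rep (code x) \<in> carrier G \<and> code (rep (code x)) = code x" if "x \<in> carrier G" for x
    unfolding rep_def by (rule someI_ex) (use that in blast)
  have "|C U| \<le>o |?I|" if "U \<in> \<U>" for U
    using VC(3)[OF that] inf by (intro card_of_countable_ordLeq) (auto simp: covers_group_def countable_finite)
  then have "|Sigma \<U> C| \<le>o |?I|"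
    using U(1) inf by (intro card_of_Sigma_ordLeq_infinite) auto
  then have "|Pow (Sigma \<U> C)| \<le>o |Pow ?I|" by (rule card_of_Pow_ordLeq)
  moreover have "|code ` carrier G| \<le>o |Pow (Sigma \<U> C)|"
    by (rule card_of_mono1) (auto simp: code_def)
  ultimately have "|code ` carrier G| \<le>o |Pow ?I|" by (rule ordLeq_transitive[rotated])
  moreover have "|F| \<le>o |code ` carrier G|" unfolding F_def by (rule card_of_image)
  ultimately have Fcard: "|F| \<le>o |Pow ?I|" by (rule ordLeq_transitive[rotated])
  have Fc: "F \<subseteq> carrier G" using rep by (auto simp: F_def)
  have "card_dense_in ?I T D" if D: "subgroup D G" "A n \<subseteq> D" "F \<subseteq> D" for D
    unfolding card_dense_in_def
  proof (intro conjI allI impI)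
    show "D \<subseteq> topspace T" using D(1) subgroup.subset topspace_eq_carrier by blast
    fix \<P> assume P: "|\<P>| \<le>o |?I|" "\<forall>P\<in>\<P>. openin T P" "topspace T \<inter> \<Inter>\<P> \<noteq> {}"
    then obtain x where x: "x \<in> carrier G" "\<And>P. P \<in> \<P> \<Longrightarrow> x \<in> P"
      unfolding topspace_eq_carrier by blast
    define f where "f = rep (code x)"
    have f: "f \<in> carrier G" "code f = code x" using rep[OF x(1)] by (auto simp: f_def)
    have fF: "f \<in> F" using x(1) by (simp add: F_def f_def)
    \<comment> \<open>Since \<open>f\<close> and \<open>x\<close> have the same code, they share a
      translate of each \<open>V U\<close>; hence \<open>inv f \<otimes> x\<close> is a product of
      two elements of \<open>V U\<close>, and \<open>z\<close> lies in every
      \<open>U\<close>.\<close>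
    define z where "z = a \<otimes> (inv f \<otimes> x)"
    have zc: "z \<in> carrier G" using a f x by (simp add: z_def)
    have "z \<in> U" if UU: "U \<in> \<U>" for U
    proof -
      obtain c where c: "c \<in> C U" "inv c \<otimes> x \<in> V U"
        using VC(3)[OF UU] x(1) unfolding covers_group_def by blast
      then have cc: "c \<in> carrier G" using VC(3)[OF UU] by (auto simp: covers_group_def)
      have "(U, c) \<in> code x" using c UU by (simp add: code_def)
      then have "(U, c) \<in> code f" using f by simp
      then have "inv c \<otimes> f \<in> V U" by (simp add: code_def)
      then have "inv (inv c \<otimes> f) \<in> V U" using VC(1)[OF UU] by (simp add: sym_nbhd_def)
      then have "a \<otimes> (inv (inv c \<otimes> f) \<otimes> (inv c \<otimes> x)) \<in> U" using VC(2)[OF UU] c(2) by blast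
      moreover have "inv (inv c \<otimes> f) \<otimes> (inv c \<otimes> x) = inv f \<otimes> x"
      proof -
        have "inv (inv c \<otimes> f) = inv f \<otimes> c" using cc f by (simp add: inv_mult_group)
        moreover have "c \<otimes> (inv c \<otimes> x) = x" using cc x by (simp add: m_assoc[symmetric])
        ultimately show ?thesis using cc f x by (simp add: m_assoc)
      qed
      ultimately show ?thesis by (simp add: z_def)
    qed
    then have zU: "z \<in> \<Inter>\<U>" by blast
    define b where "b = f \<otimes> inv a"
    have b: "b \<in> carrier G" using f a by (simp add: b_def)
    have bz: "b \<otimes> z = x"
    proof -
      have "b \<otimes> z = f \<otimes> (inv a \<otimes> (a \<otimes> (inv f \<otimes> x)))" using f a x by (simp add: b_def z_def m_assoc)
      also have "inv a \<otimes> (a \<otimes> (inv f \<otimes> x)) = inv f \<otimes> x"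
        using f a x m_assoc[of "inv a" a "inv f \<otimes> x"] by simp
      also have "f \<otimes> (inv f \<otimes> x) = x" using f x m_assoc[of f "inv f" x] by simp
      finally show ?thesis .
    qed
    \<comment> \<open>Translation by \<open>b\<close>, an element of \<open>D\<close>, carries
      \<open>z\<close> to \<open>x\<close>. Pulling the sets \<open>P\<close> back to
      \<open>z\<close> lets density of \<open>A n\<close> apply; the point found is then moved back
      within \<open>D\<close>.\<close>
    let ?\<Q> = "(\<lambda>P. {y \<in> carrier G. b \<otimes> y \<in> P}) ` \<P>"
    have "A n \<inter> topspace T \<inter> \<Inter>\<U> \<inter> \<Inter>?\<Q> \<noteq> {}"
    proof (rule dense)
      show "|?\<Q>| \<le>o |?I|" using P(1) card_of_image ordLeq_transitive by blast
      show "openin T Q" if "Q \<in> ?\<Q>" for Q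
        using that P(2) openin_translation[OF _ b] by blast
      have "z \<in> \<Inter>?\<Q>" using x(2) zc bz by auto
      then show "topspace T \<inter> \<Inter>\<U> \<inter> \<Inter>?\<Q> \<noteq> {}" using zc zU unfolding topspace_eq_carrier by blast
    qed
    then obtain y where y: "y \<in> A n" "\<And>P. P \<in> \<P> \<Longrightarrow> b \<otimes> y \<in> P" by blast
    have "b \<in> D" unfolding b_def
      using D fF a(1) by (meson subgroup.m_closed subgroup.m_inv_closed subsetD)
    then have "b \<otimes> y \<in> D" using D y(1) by (meson subgroup.m_closed subsetD)
    with y(2) show "D \<inter> \<Inter>\<P> \<noteq> {}" by blast
  qed
  then show ?thesis using Fc Fcard by (intro exI[of _ n] exI[of _ F]) simp
qed

end

section \<open>The bound on the free rank\<close>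

theorem theorem3p4:
  fixes \<alpha> :: "'i rel"
    and G :: "('a, 'm) monoid_scheme"
    and T :: "'a topology"
  assumes "Cinfinite \<alpha>"
    and "topological_group G T"
    and "comm_group G"
    and "alpha_pseudocompact \<alpha> T"
    and "c_extremal \<alpha> G T"
  shows "free_rank G \<le>o ctwo ^c \<alpha>"
proof -
  interpret topological_comm_group G T
    using assms(2,3) by (simp add: topological_comm_group_def)
  let ?I = "Field \<alpha>" and ?C = "Pow (Field \<alpha>)"
  have inf: "infinite ?I" using assms(1) by (simp add: cinfinite_def)
  then have infC: "infinite ?C" by simp
  have pow: "|?C| =o ctwo ^c \<alpha>"
    unfolding ctwo_def cexp_def Field_card_of by (rule card_of_Pow_Func)
  have tb: "\<exists>F. covers_group F V" if "openin T V" "\<one>\<^bsub>G\<^esub> \<in> V" for V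
    using pseudocompact_totally_bounded[OF assms(4) _ that] inf by fastforce
  define X where "X = (SOME X. maximal_independent G X)"
  have X: "maximal_independent G X"
    unfolding X_def using maximal_independent_exists[OF assms(3)] by (rule someI_ex)
  then have ind: "group_independent G X" by (simp add: maximal_independent_def)
  then have XG: "X \<subseteq> carrier G" by (simp add: group_independent_def)
  have "|X| \<le>o |?C|"
  proof (cases "finite X")
    case True
    then show ?thesis using infC by (simp add: card_of_countable_ordLeq countable_finite)
  next
    case False
    then have "|UNIV :: nat set| \<le>o |X|" using infinite_iff_card_of_nat by blast
    then have "|X \<times> (UNIV :: nat set)| =o |X|"
      using False card_of_Times_infinite by blast
    then obtain b where b: "bij_betw b (X \<times> (UNIV :: nat set)) X" using card_of_ordIso by blast
    define Xn where "Xn n = b ` (X \<times> {n})" for n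
    have XnX: "Xn n \<subseteq> X" for n using b by (auto simp: Xn_def bij_betw_def)
    have disj: "Xn m \<inter> Xn n = {}" if "m \<noteq> n" for m n
      using b that by (auto simp: Xn_def bij_betw_def inj_on_def)
    have card_Xn: "|X| \<le>o |Xn n|" for n
    proof (rule card_of_ordLeqI[of "\<lambda>x. b (x, n)"])
      show "inj_on (\<lambda>x. b (x, n)) X" using b by (auto simp: bij_betw_def inj_on_def)
    qed (simp add: Xn_def)
    have cover: "carrier G \<subseteq> (\<Union>n. pure_span G (X - Xn n))"
    proof
      fix g assume "g \<in> carrier G"
      then have "g \<in> pure_span G X" using maximal_independent_pure_span[OF X] by blast
      then obtain E where E: "finite E" "E \<subseteq> X" "g \<in> pure_span G E" by (rule pure_span_finite_support)
      \<comment> \<open>Points of \<open>E\<close> chosen from all the disjoint pieces would form an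
        infinite subset of \<open>E\<close>.\<close>
      have "\<exists>n. E \<inter> Xn n = {}"
      proof (rule ccontr)
        assume "\<not> ?thesis"
        then have "\<exists>y. y \<in> E \<inter> Xn n" for n by blast
        then obtain w where w: "\<And>n. w n \<in> E \<inter> Xn n" by metis
        have "inj w"
        proof (rule injI)
          fix i j assume "w i = w j"
          then have "w i \<in> Xn i \<inter> Xn j" using w[of i] w[of j] by auto
          then show "i = j" using disj[of i j] by blast
        qed
        moreover have "range w \<subseteq> E" using w by blast
        ultimately show False using E(1) finite_subset[of "range w" E] finite_imageD[of w UNIV] by simp
      qed
      then obtain n where "E \<subseteq> X - Xn n" using E(2) by blast
      then show "g \<in> (\<Union>n. pure_span G (X - Xn n))" using pure_span_mono E(3) by blast
    qed
    obtain n F where F: "F \<subseteq> carrier G" "|F| \<le>o |?C|"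
      and dense: "\<And>D. subgroup D G \<Longrightarrow> pure_span G (X - Xn n) \<subseteq> D \<Longrightarrow> F \<subseteq> D \<Longrightarrow> card_dense_in ?I T D"
      using card_dense_subgroups_of_cover[OF tb assms(4) inf cover] by blast
    have "\<exists>E. finite E \<and> E \<subseteq> X \<and> f \<in> pure_span G E" if "f \<in> F" for f
    proof -
      have "f \<in> pure_span G X" using that F(1) maximal_independent_pure_span[OF X] by blast
      then show ?thesis by (rule pure_span_finite_support) blast
    qed
    then obtain supp where supp: "\<And>f. f \<in> F \<Longrightarrow> finite (supp f) \<and> supp f \<subseteq> X \<and> f \<in> pure_span G (supp f)"
      by metis
    \<comment> \<open>\<open>Y\<close> collects finite supports, so that the pure span of any set
      containing it contains \<open>F\<close>, while its cardinality stays at most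
      \<open>2^\<alpha>\<close>.\<close>
    define Y where "Y = (\<Union>f\<in>F. supp f)"
    have "|Y| \<le>o |?C|"
      unfolding Y_def
    proof (rule card_of_UNION_ordLeq_infinite[OF infC F(2)], intro ballI)
      show "|supp f| \<le>o |?C|" if "f \<in> F" for f
        using supp[OF that] infC by (simp add: card_of_countable_ordLeq countable_finite)
    qed
    define B where "B = X - Xn n \<union> Y"
    have BX: "B \<subseteq> X" using supp by (auto simp: B_def Y_def)
    let ?D = "pure_span G B"
    have sub: "subgroup ?D G" using subgroup_pure_span BX XG by blast
    have "F \<subseteq> ?D"
    proof
      fix f assume "f \<in> F"
      then have "f \<in> pure_span G (supp f)" "supp f \<subseteq> B" using supp by (auto simp: B_def Y_def)
      then show "f \<in> ?D" using pure_span_mono by blast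
    qed
    then have D: "card_dense_in ?I T ?D"
      using sub by (intro dense pure_span_mono) (auto simp: B_def)
    have "free_rank (G Mod ?D) <o ctwo ^c \<alpha>"
      using assms(5) sub card_dense_in_closure_of[OF D inf]
        alpha_pseudocompact_dense_subset[OF tb assms(4) inf D]
      unfolding c_extremal_def by blast
    moreover define Q where "Q = (SOME Q. maximal_independent (G Mod ?D) Q)"
    ultimately have "|Q| <o ctwo ^c \<alpha>" by (simp add: free_rank_def)
    then have Qle: "|Q| \<le>o |?C|"
      using pow ordLess_imp_ordLeq ordLeq_ordIso_trans ordIso_symmetric by blast
    have "maximal_independent (G Mod ?D) Q"
      unfolding Q_def using maximal_independent_exists[OF abelian_FactGroup[OF sub]] by (rule someI_ex)
    then have "|X - B| \<le>o |?C|"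
      using card_independent_le_quotient[OF ind BX infC _ Qle] by blast
    then have "|(X - B) \<union> Y| \<le>o |?C|"
      using card_of_Un_ordLeq_infinite_Field[of "|?C|"] infC \<open>|Y| \<le>o |?C|\<close>
      by (simp add: Field_card_of card_of_card_order_on)
    \<comment> \<open>\<open>X - B\<close> is \<open>Xn n - Y\<close>, so adding \<open>Y\<close>
      recovers the whole piece, which has the cardinality of \<open>X\<close>.\<close>
    moreover have "|Xn n| \<le>o |(X - B) \<union> Y|"
      using XnX by (intro card_of_mono1) (auto simp: B_def)
    ultimately show ?thesis using card_Xn ordLeq_transitive by blast
  qed
  then show ?thesis
    unfolding free_rank_def X_def[symmetric] using pow ordLeq_ordIso_trans by blast
qed

end
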